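(* Let $a>0$ and $m\ne0$ be fixed. The singular Cauchy problem for $f=f(\Phi)$, $$\frac{d}{d\Phi}\big(f\dot f+\Phi f\big)=\frac{2m-1}{m}\,f,\quad \Phi>-a,\qquad \lim_{\Phi\to-a+0}f(\Phi)=0,\quad \lim_{\Phi\to-a+0}\dot f(\Phi)=a,$$ has a unique solution $f_m(\Phi,a)$; it is holomorphic at $\Phi=-a$: $$f_m(\Phi,a)=a(\Phi+a)\Big[1+\sum_{k=1}^\infty\chi_{m,k}(\Phi+a)^k/a^k\Big],$$ where $\chi_{m,1}=-1/(4m)$ and, for $k=2,3,\dots$, $$\chi_{m,k}=(k+1)^{-2}\Big\{-\chi_{m,k-1}\frac{1+m(k-1)}{m}-\sum_{l=1}^{k-1}[l(k+3)+1]\chi_{m,l}\chi_{m,k-l}\Big\}.$$ For $m=\infty$ and $m=1/2$ there are the exact solutions $$f_\infty(\Phi,a)=a(\Phi+a),\qquad f_{1/2}(\Phi,a)=(a^2-\Phi^2)/2=a(\Phi+a)\Big[1-\frac{\Phi+a}{2a}\Big].$$ Moreover, for $1/2<m<\infty$ the solution $f_m(\Phi,a)$ exists globally and is positive on $(-a,\infty)$.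
   Context: A dot denotes $d/d\Phi$. The case $m=\infty$ means that the coefficient $(2m-1)/m$ is replaced by $2$. *)

theory Defs
  imports "HOL-Analysis.Analysis"
begin

text \<open>
  The parameter \<open>m\<close> ranges over the nonzero reals together with \<open>\<infinity>\<close>; expressions in \<open>m\<close> are
  understood at \<open>m = \<infinity>\<close> as their limits for \<open>m \<rightarrow> \<infinity>\<close>. They are given case by case because \<open>ereal\<close>
  arithmetic at \<open>\<infinity>\<close> does not produce these limits (for instance \<open>\<infinity> / \<infinity> = 0\<close>). The value \<open>-\<infinity>\<close>
  is not meant to be used.
\<close>

definition ode_coeff :: "ereal \<Rightarrow> real" where
  "ode_coeff m = (case m of ereal r \<Rightarrow> (2 * r - 1) / r | _ \<Rightarrow> 2)"

text \<open>
  A solution lives on an interval \<open>(-a, b)\<close> to the right of the singular point, with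
  \<open>-a < b \<le> \<infinity>\<close>; the values of \<open>f\<close> outside of it are irrelevant. Neither positivity of \<open>f\<close> nor
  regularity beyond what is needed to make sense of the equation is required.
\<close>

definition cauchy_solution :: "ereal \<Rightarrow> real \<Rightarrow> ereal \<Rightarrow> (real \<Rightarrow> real) \<Rightarrow> bool" where
  "cauchy_solution m a b f \<longleftrightarrow>
     ereal (- a) < b \<and>
     (\<forall>\<Phi>. - a < \<Phi> \<and> ereal \<Phi> < b \<longrightarrow>
        f differentiable (at \<Phi>) \<and>
        ((\<lambda>x. f x * deriv f x + x * f x) has_real_derivative ode_coeff m * f \<Phi>) (at \<Phi>)) \<and>
     (f \<longlongrightarrow> 0) (at_right (- a)) \<and>
     (deriv f \<longlongrightarrow> a) (at_right (- a))"

text \<open>Only the indices \<open>k \<ge> 1\<close> of \<open>chi m k\<close> are meaningful.\<close>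

function chi :: "ereal \<Rightarrow> nat \<Rightarrow> real" where
  "chi m k =
    (if k = 0 then 0
     else if k = 1 then (case m of ereal r \<Rightarrow> - 1 / (4 * r) | _ \<Rightarrow> 0)
     else (- chi m (k - 1) * (case m of ereal r \<Rightarrow> (1 + r * real (k - 1)) / r | _ \<Rightarrow> real (k - 1))
           - (\<Sum>l = 1..k - 1. real (l * (k + 3) + 1) * chi m l * chi m (k - l)))
          / (real k + 1)\<^sup>2)"
  by auto
termination
  by (relation "Wellfounded.measure snd") auto

declare chi.simps [simp del]

end

theory Submission imports Defs begin

text \<open>
  Write \<open>A = f * f' + \<Phi> * f\<close> for the flux, so that the equation is \<open>A' = k * f\<close> with
  \<open>k = ode_coeff m\<close>, and \<open>A\<close> tends to \<open>0\<close> at the singular point \<open>- a\<close>.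

  Local existence comes from the power series. After scaling by \<open>a\<close>, comparison of coefficients in
  the equation is the recursion for \<open>chi\<close> (\<open>profile_fps_ode\<close>). The series converges because the
  partial sums of \<open>\<bar>chi m k\<bar> * e ^ k\<close> satisfy a quadratic inequality that keeps them below \<open>1 / 4\<close>
  when \<open>e\<close> is small (\<open>chi_geometric_bound\<close>).

  Uniqueness has three ingredients. Near \<open>- a\<close> both solutions are close to \<open>a * (\<Phi> + a)\<close>, and a
  bound \<open>S * (\<Phi> + a)\<close> for their difference can be improved to \<open>S / 2 * (\<Phi> + a)\<close>
  (\<open>local_uniqueness\<close>). As long as the solutions are positive, the equation is a regular system for
  \<open>f\<close> and \<open>A\<close> and Gronwall's argument applies (\<open>regular_uniqueness\<close>). Finally, for \<open>k \<noteq> 0\<close> a solution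
  never vanishes: a zero of \<open>f\<close> is a zero of \<open>A\<close>, which is impossible because \<open>A\<close> starts from \<open>0\<close>
  and is strictly monotone while \<open>f > 0\<close> (\<open>cauchy_solution_pos\<close>). For \<open>k = 0\<close>, that is
  \<open>m = 1 / 2\<close>, the flux is identically \<open>0\<close> and the solution, which does cross zero, is found
  explicitly (\<open>solution_zero_coeff\<close>).

  Uniqueness makes all solutions restrictions of a single maximal one (\<open>maximal_solution\<close>). It
  remains to see how far it extends. For \<open>m = \<infinity>\<close> and \<open>m = 1 / 2\<close> the explicit solutions are global.
  For \<open>1 / 2 < m < \<infinity>\<close> one has \<open>k > 0\<close>, hence the flux is positive and increasing. It keeps \<open>f\<close> away
  from \<open>0\<close> on bounded intervals, and in the variables \<open>f\<^sup>2 / 2\<close> and \<open>A\<close> the right-hand sides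
  grow at most linearly, so that the solution reaches every \<open>T\<close> (\<open>regular_continuation\<close>,
  \<open>solution_extends\<close>).
\<close>

section \<open>Auxiliary calculus\<close>

text \<open>
  At the singular point solutions and their fluxes have limits but no prescribed values, so the
  mean value theorem is needed with a limit in place of the value at the left end.
\<close>

lemma mvt_right:
  fixes h :: "real \<Rightarrow> real"
  assumes "p < z"
    and deriv: "\<And>x. p < x \<Longrightarrow> x < z \<Longrightarrow> (h has_real_derivative h' x) (at x)"
    and cont: "isCont h z"
    and lim: "(h \<longlongrightarrow> l) (at_right p)"
  obtains \<xi> where "p < \<xi>" "\<xi> < z" "h z - l = h' \<xi> * (z - p)"
proof -
  define k where "k = (\<lambda>x. if x \<le> p then l else h x)"
  have k_eq: "eventually (\<lambda>y. k y = h y) (nhds x)" if "p < x" for x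
    using eventually_nhds_in_open[of "{p<..}" x] that
    by (auto simp: k_def elim!: eventually_mono)
  have kd: "(k has_real_derivative h' x) (at x)" if "p < x" "x < z" for x
    using deriv[OF that] DERIV_cong_ev[OF refl k_eq[OF that(1)] refl] by blast
  have kz: "isCont k z"
    using cont isCont_cong[OF k_eq[OF \<open>p < z\<close>]] by simp
  have "continuous_on {p..z} k"
    unfolding continuous_on_eq_continuous_within
  proof
    fix x assume x: "x \<in> {p..z}"
    show "continuous (at x within {p..z}) k"
    proof (cases "x = p")
      case True
      have "(k \<longlongrightarrow> l) (at_right p)"
        by (rule Lim_transform_eventually[OF lim])
           (auto simp: k_def eventually_at_filter)
      then show ?thesis
        using True \<open>p < z\<close> by (simp add: continuous_within k_def at_within_Icc_at_right)
    next
      case False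
      then have "isCont k x"
        using x kz DERIV_isCont[OF kd] by (cases "x = z") auto
      then show ?thesis by (rule continuous_at_imp_continuous_at_within)
    qed
  qed
  then obtain d \<xi> where "p < \<xi>" "\<xi> < z" "DERIV k \<xi> :> d" "k z - k p = (z - p) * d"
    using MVT[OF \<open>p < z\<close>, of k] kd real_differentiable_def by blast
  moreover from this have "d = h' \<xi>"
    using kd DERIV_unique by blast
  ultimately show thesis
    using that[of \<xi>] \<open>p < z\<close> by (simp add: k_def mult.commute)
qed

lemma abs_le_of_deriv_bound:
  fixes h :: "real \<Rightarrow> real"
  assumes "p < x" "x < q"
    and deriv: "\<And>y. p < y \<Longrightarrow> y < q \<Longrightarrow> (h has_real_derivative h' y) (at y)"
    and bound: "\<And>y. p < y \<Longrightarrow> y < q \<Longrightarrow> \<bar>h' y\<bar> \<le> K"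
    and lim: "(h \<longlongrightarrow> 0) (at_right p)"
  shows "\<bar>h x\<bar> \<le> K * (x - p)"
proof -
  obtain \<xi> where "p < \<xi>" "\<xi> < x" "h x - 0 = h' \<xi> * (x - p)"
    using mvt_right[OF \<open>p < x\<close>, of h h' 0] deriv assms(1,2) lim DERIV_isCont
    by (metis order_less_trans)
  then show ?thesis
    using bound[of \<xi>] \<open>p < x\<close> \<open>x < q\<close> by (simp add: abs_mult mult_right_mono)
qed

text \<open>
  The points where \<open>g\<close> is not positive stay away from \<open>p\<close>, so those up to \<open>y\<close> form a compact
  set; its least element is the zero.
\<close>

lemma first_zero:
  fixes g :: "real \<Rightarrow> real"
  assumes pos: "eventually (\<lambda>x. 0 < g x) (at_right p)"
    and cont: "\<And>x. p < x \<Longrightarrow> x \<le> y \<Longrightarrow> isCont g x"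
    and y: "p < y" "g y \<le> 0"
  obtains z where "p < z" "z \<le> y" "g z = 0" "\<And>x. p < x \<Longrightarrow> x < z \<Longrightarrow> 0 < g x"
proof -
  obtain q where q: "p < q" "\<And>x. p < x \<Longrightarrow> x < q \<Longrightarrow> 0 < g x"
    using pos by (auto simp: eventually_at_right_field)
  define t where "t = (p + min q y) / 2"
  have t: "p < t" "t < q" "t < y"
    using q(1) y(1) by (auto simp: t_def min_def field_simps)
  define S where "S = {t..y} \<inter> g -` {..0}"
  have "compact S"
    unfolding S_def compact_eq_bounded_closed
    by (intro conjI continuous_closed_preimage continuous_at_imp_continuous_on)
       (use t cont in \<open>auto simp: bounded_Int\<close>)
  moreover have "y \<in> S" using t y by (auto simp: S_def)
  ultimately obtain z where z: "z \<in> S" "\<And>x. x \<in> S \<Longrightarrow> z \<le> x"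
    using compact_attains_inf[of S] by blast
  have below: "0 < g x" if "p < x" "x < z" for x
    using z(2)[of x] that q(2)[of x] t z(1) by (force simp: S_def)
  have zb: "t \<le> z" "z \<le> y" "g z \<le> 0" using z by (auto simp: S_def)
  have "0 \<le> g z"
  proof (rule tendsto_lowerbound)
    show "(g \<longlongrightarrow> g z) (at_left z)"
      using cont[of z] t zb by (simp add: isCont_def filterlim_at_split)
    show "eventually (\<lambda>x. 0 \<le> g x) (at_left z)"
      unfolding eventually_at_left_field using below t zb
      by (intro exI[of _ p]) (auto intro: less_imp_le)
  qed auto
  then show thesis using that[of z] below t zb by auto
qed

section \<open>Solutions near the singular point and their sign\<close>

text \<open>
  The expression under the outer derivative of the equation, which thus becomes
  \<open>(flux f)' = ode_coeff m * f\<close>. The pair of \<open>f\<close> and \<open>flux f\<close> solves a first-order system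
  \<open>f' = A / f - x, A' = k * f\<close> that is regular as long as \<open>f\<close> does not vanish.
\<close>

definition flux :: "(real \<Rightarrow> real) \<Rightarrow> real \<Rightarrow> real" where
  "flux f x = f x * deriv f x + x * f x"

lemma cauchy_solution_flux:
  "cauchy_solution m a b f \<longleftrightarrow>
     ereal (- a) < b \<and>
     (\<forall>x. - a < x \<and> ereal x < b \<longrightarrow> (f has_real_derivative deriv f x) (at x) \<and>
        (flux f has_real_derivative ode_coeff m * f x) (at x)) \<and>
     (f \<longlongrightarrow> 0) (at_right (- a)) \<and> (deriv f \<longlongrightarrow> a) (at_right (- a))"
  unfolding cauchy_solution_def flux_def[abs_def] real_differentiable_def
  by (metis DERIV_imp_deriv)

lemma cauchy_solutionD:
  assumes "cauchy_solution m a b f"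
  shows "ereal (- a) < b"
    and "\<And>x. - a < x \<Longrightarrow> ereal x < b \<Longrightarrow> (f has_real_derivative deriv f x) (at x)"
    and "\<And>x. - a < x \<Longrightarrow> ereal x < b \<Longrightarrow> (flux f has_real_derivative ode_coeff m * f x) (at x)"
    and "(f \<longlongrightarrow> 0) (at_right (- a))"
    and "(deriv f \<longlongrightarrow> a) (at_right (- a))"
  using assms by (auto simp: cauchy_solution_flux)

lemma cauchy_solution_restrict:
  "cauchy_solution m a b f \<Longrightarrow> ereal (- a) < c \<Longrightarrow> c \<le> b \<Longrightarrow> cauchy_solution m a c f"
  unfolding cauchy_solution_def by (meson order_less_le_trans)

lemma flux_tendsto_0:
  assumes "cauchy_solution m a b f"
  shows "(flux f \<longlongrightarrow> 0) (at_right (- a))"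
proof -
  have "((\<lambda>x. f x * deriv f x + x * f x) \<longlongrightarrow> 0 * a + (- a) * 0) (at_right (- a))"
    by (intro tendsto_intros cauchy_solutionD[OF assms])
  then show ?thesis by (simp add: flux_def[abs_def])
qed

lemma ereal_upper_nhd:
  assumes "ereal p < b"
  obtains q where "p < q" "\<And>x. x \<le> q \<Longrightarrow> ereal x < b"
proof -
  obtain q where "ereal p < ereal q" "ereal q < b" using ereal_dense2[OF assms] by blast
  then show thesis using that[of q] by (metis ereal_less_eq(3) le_less_trans less_ereal.simps(1))
qed

text \<open>
  The slope \<open>a\<close> at the singular point confines \<open>f\<close> to the vicinity of the line
  \<open>a * (x + a)\<close>; the lower bound is what makes division by \<open>f\<close> harmless there.
\<close>

lemma cauchy_solution_near:
  assumes sol: "cauchy_solution m a b f" and "0 < e"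
  obtains d where "0 < d" "\<And>x. x \<le> - a + d \<Longrightarrow> ereal x < b"
    "\<And>x. - a < x \<Longrightarrow> x < - a + d \<Longrightarrow> \<bar>deriv f x - a\<bar> < e"
    "\<And>x. - a < x \<Longrightarrow> x < - a + d \<Longrightarrow> (a - e) * (x + a) < f x"
proof -
  obtain q where q: "- a < q" "\<And>x. x \<le> q \<Longrightarrow> ereal x < b"
    using ereal_upper_nhd[OF cauchy_solutionD(1)[OF sol]] by blast
  have "eventually (\<lambda>x. dist (deriv f x) a < e) (at_right (- a))"
    using cauchy_solutionD(5)[OF sol] \<open>0 < e\<close> by (rule tendstoD)
  then obtain r where r: "- a < r" "\<And>x. - a < x \<Longrightarrow> x < r \<Longrightarrow> \<bar>deriv f x - a\<bar> < e"
    by (auto simp: eventually_at_right_field dist_real_def)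
  define d where "d = min q r + a"
  have d: "0 < d" "- a + d \<le> q" "- a + d \<le> r" using q(1) r(1) by (auto simp: d_def)
  have lower: "(a - e) * (x + a) < f x" if x: "- a < x" "x < - a + d" for x
  proof -
    have D: "(f has_real_derivative deriv f y) (at y)" if "- a < y" "y \<le> x" for y
      using cauchy_solutionD(2)[OF sol] that x q(2) d by simp
    obtain \<xi> where \<xi>: "- a < \<xi>" "\<xi> < x" "f x - 0 = deriv f \<xi> * (x - - a)"
      by (rule mvt_right[OF x(1), of f "deriv f" 0])
         (use D x cauchy_solutionD(4)[OF sol] in \<open>auto intro: DERIV_isCont\<close>)
    then have "\<bar>deriv f \<xi> - a\<bar> < e" using r(2) x d by simp
    then have "(a - e) * (x + a) < deriv f \<xi> * (x + a)"
      using x by (intro mult_strict_right_mono) auto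
    then show ?thesis using \<xi>(3) by simp
  qed
  show thesis
    by (rule that[OF d(1)]) (use q(2) r(2) d lower in auto)
qed

lemma cauchy_solution_eventually_pos:
  assumes "cauchy_solution m a b f" "0 < a"
  shows "eventually (\<lambda>x. 0 < f x) (at_right (- a))"
proof -
  obtain d where d: "0 < d" "\<And>x. - a < x \<Longrightarrow> x < - a + d \<Longrightarrow> (a - a) * (x + a) < f x"
    using cauchy_solution_near[OF assms] by metis
  then show ?thesis
    unfolding eventually_at_right_field by (intro exI[of _ "- a + d"]) auto
qed

lemma cauchy_solution_isCont:
  "cauchy_solution m a b f \<Longrightarrow> - a < x \<Longrightarrow> ereal x < b \<Longrightarrow> isCont f x"
  using cauchy_solutionD(2) DERIV_isCont by blast

text \<open>
  At a zero of \<open>f\<close> the flux vanishes, because \<open>f\<close> is differentiable there. The flux also tends to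
  \<open>0\<close> at the singular point, so by Rolle its derivative \<open>ode_coeff m * f\<close> vanishes somewhere in
  between. At the first zero of \<open>f\<close> this contradicts \<open>f > 0\<close> before it.
\<close>

lemma cauchy_solution_pos:
  assumes sol: "cauchy_solution m a b f" and "0 < a" and k: "ode_coeff m \<noteq> 0"
    and x: "- a < x" "ereal x < b"
  shows "0 < f x"
proof (rule ccontr)
  assume "\<not> 0 < f x"
  then have "f x \<le> 0" by simp
  have dom: "ereal y < b" if "y \<le> x" for y
    using that x by (metis ereal_less_eq(3) le_less_trans)
  obtain z where z: "- a < z" "z \<le> x" "f z = 0" "\<And>y. - a < y \<Longrightarrow> y < z \<Longrightarrow> 0 < f y"
    using first_zero[OF cauchy_solution_eventually_pos[OF sol \<open>0 < a\<close>] _ x(1) \<open>f x \<le> 0\<close>]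
      cauchy_solution_isCont[OF sol] dom by metis
  have D: "(flux f has_real_derivative ode_coeff m * f y) (at y)" if "- a < y" "y \<le> z" for y
    using cauchy_solutionD(3)[OF sol] that z dom by auto
  obtain y where y: "- a < y" "y < z" "flux f z - 0 = ode_coeff m * f y * (z - - a)"
    by (rule mvt_right[OF z(1), of "flux f" "\<lambda>y. ode_coeff m * f y" 0])
       (use D z flux_tendsto_0[OF sol] in \<open>auto intro: DERIV_isCont\<close>)
  moreover have "flux f z = 0" using z by (simp add: flux_def)
  ultimately show False using z(4)[of y] k by auto
qed

section \<open>Uniqueness\<close>

text \<open>
  Multiplying the difference of the derivatives by \<open>f\<close> gives
  \<open>f * (f' - g') = (flux f - flux g) - (f - g) * (g' + x)\<close>, where \<open>g' + x\<close> tends to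
  \<open>a - a = 0\<close>. If \<open>\<bar>f - g\<bar> \<le> S * (x + a)\<close>, then the first term is of second order in \<open>x + a\<close>
  and the second is a small multiple of \<open>S * (x + a)\<close>; dividing by \<open>f\<close>, which is comparable
  to \<open>a * (x + a)\<close>, leaves \<open>\<bar>f' - g'\<bar> \<le> S / 2\<close> close to \<open>- a\<close>. Integration halves the constant
  \<open>S\<close>, and iteration makes the difference vanish.
\<close>

lemma local_uniqueness:
  assumes f: "cauchy_solution m a b f" and g: "cauchy_solution m a c g" and "0 < a"
  obtains d where "0 < d" "\<And>x. - a < x \<Longrightarrow> x < - a + d \<Longrightarrow> f x = g x"
proof -
  let ?k = "\<bar>ode_coeff m\<bar>"
  have "0 < a / 8" using \<open>0 < a\<close> by simp
  obtain d1 where d1: "0 < d1" "\<And>x. x \<le> - a + d1 \<Longrightarrow> ereal x < b"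
    "\<And>x. - a < x \<Longrightarrow> x < - a + d1 \<Longrightarrow> \<bar>deriv f x - a\<bar> < a / 8"
    "\<And>x. - a < x \<Longrightarrow> x < - a + d1 \<Longrightarrow> (a - a / 8) * (x + a) < f x"
    using cauchy_solution_near[OF f \<open>0 < a / 8\<close>] by metis
  obtain d2 where d2: "0 < d2" "\<And>x. x \<le> - a + d2 \<Longrightarrow> ereal x < c"
    "\<And>x. - a < x \<Longrightarrow> x < - a + d2 \<Longrightarrow> \<bar>deriv g x - a\<bar> < a / 8"
    using cauchy_solution_near[OF g \<open>0 < a / 8\<close>] by metis
  \<comment> \<open>The third bound makes the contraction factor at most 1/2; see the estimate in terms of a / 4 below.\<close>
  define d where "d = Min {d1, d2, a / 8 / (?k + 1)}"
  have d: "0 < d" "d \<le> d1" "d \<le> d2" using d1 d2 \<open>0 < a\<close> by (auto simp: d_def)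
  have "d \<le> a / 8 / (?k + 1)" by (simp add: d_def)
  then have dk: "?k * d + d \<le> a / 8" by (simp add: pos_le_divide_eq algebra_simps)
  define q where "q = - a + d"
  have Df: "(f has_real_derivative deriv f x) (at x)"
    "(flux f has_real_derivative ode_coeff m * f x) (at x)"
    and Dg: "(g has_real_derivative deriv g x) (at x)"
    "(flux g has_real_derivative ode_coeff m * g x) (at x)"
    and near: "\<bar>deriv f x - a\<bar> < a / 8" "\<bar>deriv g x - a\<bar> < a / 8" "(a - a / 8) * (x + a) < f x"
    if "- a < x" "x < q" for x
    using that d1 d2 d cauchy_solutionD(2,3)[OF f] cauchy_solutionD(2,3)[OF g]
    by (auto simp: q_def)
  have lim: "((\<lambda>x. f x - g x) \<longlongrightarrow> 0) (at_right (- a))"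
    using tendsto_diff[OF cauchy_solutionD(4)[OF f] cauchy_solutionD(4)[OF g]] by simp
  have lim': "((\<lambda>x. flux f x - flux g x) \<longlongrightarrow> 0) (at_right (- a))"
    using tendsto_diff[OF flux_tendsto_0[OF f] flux_tendsto_0[OF g]] by simp
  have halve: "\<bar>f x - g x\<bar> \<le> (S / 2) * (x + a)"
    if S: "0 \<le> S" "\<And>x. - a < x \<Longrightarrow> x < q \<Longrightarrow> \<bar>f x - g x\<bar> \<le> S * (x + a)"
      and x: "- a < x" "x < q" for S x
  proof -
    have flux: "\<bar>flux f y - flux g y\<bar> \<le> ?k * S * d * (y + a)" if y: "- a < y" "y < q" for y
    proof -
      have "\<bar>flux f y - flux g y\<bar> \<le> (?k * S * d) * (y - - a)"
      proof (rule abs_le_of_deriv_bound[OF y _ _ lim'])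
        fix t assume t: "- a < t" "t < q"
        show "((\<lambda>x. flux f x - flux g x) has_real_derivative ode_coeff m * (f t - g t)) (at t)"
          using DERIV_diff[OF Df(2)[OF t] Dg(2)[OF t]] by (simp add: algebra_simps)
        have "\<bar>f t - g t\<bar> \<le> S * d"
          using S(2)[OF t] mult_left_mono[of "t + a" d S] S(1) t by (simp add: q_def)
        then show "\<bar>ode_coeff m * (f t - g t)\<bar> \<le> ?k * S * d"
          by (simp add: abs_mult mult_left_mono mult.assoc)
      qed
      then show ?thesis by simp
    qed
    have "\<bar>f x - g x\<bar> \<le> (S / 2) * (x - - a)"
    proof (rule abs_le_of_deriv_bound[OF x _ _ lim])
      fix y assume y: "- a < y" "y < q"
      show "((\<lambda>x. f x - g x) has_real_derivative deriv f y - deriv g y) (at y)"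
        by (rule DERIV_diff[OF Df(1)[OF y] Dg(1)[OF y]])
      have "(a / 2) * (y + a) \<le> (a - a / 8) * (y + a)"
        using y \<open>0 < a\<close> by (intro mult_right_mono) auto
      then have f_ge: "(a / 2) * (y + a) \<le> f y" using near(3)[OF y] by simp
      moreover have "0 \<le> (a / 2) * (y + a)" using y \<open>0 < a\<close> by simp
      ultimately have f_nn: "0 \<le> f y" by linarith
      have "\<bar>deriv g y + y\<bar> \<le> a / 8 + d"
        using near(2)[OF y] y unfolding q_def by linarith
      then have 1: "\<bar>(f y - g y) * (deriv g y + y)\<bar> \<le> S * (y + a) * (a / 8 + d)"
        unfolding abs_mult using S y by (intro mult_mono) auto
      have "f y * (deriv f y - deriv g y) = (flux f y - flux g y) - (f y - g y) * (deriv g y + y)"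
        by (simp add: flux_def algebra_simps)
      then have "f y * \<bar>deriv f y - deriv g y\<bar> = \<bar>(flux f y - flux g y) - (f y - g y) * (deriv g y + y)\<bar>"
        using abs_mult[of "f y" "deriv f y - deriv g y"] f_nn by simp
      also have "\<dots> \<le> ?k * S * d * (y + a) + S * (y + a) * (a / 8 + d)"
        using flux[OF y] 1 by linarith
      also have "\<dots> = S * (y + a) * (?k * d + d + a / 8)" by (simp add: algebra_simps)
      also have "\<dots> \<le> S * (y + a) * (a / 4)"
        using dk S(1) y by (intro mult_left_mono) auto
      finally have "f y * \<bar>deriv f y - deriv g y\<bar> \<le> S * (y + a) * (a / 4)" .
      then have "(a / 2) * (y + a) * \<bar>deriv f y - deriv g y\<bar> \<le> S * (y + a) * (a / 4)"
        using mult_right_mono[OF f_ge abs_ge_zero[of "deriv f y - deriv g y"]] by linarith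
      then have "(a / 2 * (y + a)) * \<bar>deriv f y - deriv g y\<bar> \<le> (a / 2 * (y + a)) * (S / 2)"
        by (simp add: algebra_simps)
      then show "\<bar>deriv f y - deriv g y\<bar> \<le> S / 2"
        by (rule mult_left_le_imp_le) (use y \<open>0 < a\<close> in auto)
    qed
    then show ?thesis by simp
  qed
  have iterate: "\<bar>f x - g x\<bar> \<le> (a / 4) / 2 ^ n * (x + a)" if "- a < x" "x < q" for n x
    using that
  proof (induction n arbitrary: x)
    case 0
    have "\<bar>f x - g x\<bar> \<le> (a / 4) * (x - - a)"
    proof (rule abs_le_of_deriv_bound[OF 0 _ _ lim])
      fix y assume y: "- a < y" "y < q"
      show "((\<lambda>x. f x - g x) has_real_derivative deriv f y - deriv g y) (at y)"
        by (rule DERIV_diff[OF Df(1)[OF y] Dg(1)[OF y]])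
      show "\<bar>deriv f y - deriv g y\<bar> \<le> a / 4"
        using near(1,2)[OF y] by linarith
    qed
    then show ?case by simp
  next
    case (Suc n)
    then show ?case using halve[of "a / 4 / 2 ^ n" x] \<open>0 < a\<close> by (simp add: mult.commute)
  qed
  have "f x = g x" if x: "- a < x" "x < q" for x
  proof -
    have "(\<lambda>n. (a / 4 * (x + a)) * (1 / 2) ^ n) \<longlonglongrightarrow> (a / 4 * (x + a)) * 0"
      by (intro tendsto_intros LIMSEQ_power_zero) auto
    then have "(\<lambda>n. (a / 4) / 2 ^ n * (x + a)) \<longlonglongrightarrow> 0"
      by (simp add: power_divide field_simps)
    then have "\<bar>f x - g x\<bar> \<le> 0"
      by (rule LIMSEQ_le_const) (use iterate[OF x] in auto)
    then show ?thesis by simp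
  qed
  then show thesis using that[OF d(1)] by (simp add: q_def)
qed

text \<open>
  Gronwall for \<open>E = (f - g)\<^sup>2 + (A - B)\<^sup>2\<close>: as \<open>f\<close> and \<open>g\<close> are bounded away from \<open>0\<close> on
  the compact interval, \<open>E' \<le> C * E\<close>, so \<open>exp (- C * x) * E\<close> decreases from the value \<open>0\<close>.
\<close>

lemma regular_uniqueness:
  fixes f g A B :: "real \<Rightarrow> real"
  assumes "s \<le> t"
    and cont: "continuous_on {s..t} f" "continuous_on {s..t} g"
      "continuous_on {s..t} A" "continuous_on {s..t} B"
    and pos: "\<And>x. x \<in> {s..t} \<Longrightarrow> 0 < f x" "\<And>x. x \<in> {s..t} \<Longrightarrow> 0 < g x"
    and f: "\<And>x. s < x \<Longrightarrow> x < t \<Longrightarrow> (f has_real_derivative A x / f x - x) (at x)"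
      "\<And>x. s < x \<Longrightarrow> x < t \<Longrightarrow> (A has_real_derivative k * f x) (at x)"
    and g: "\<And>x. s < x \<Longrightarrow> x < t \<Longrightarrow> (g has_real_derivative B x / g x - x) (at x)"
      "\<And>x. s < x \<Longrightarrow> x < t \<Longrightarrow> (B has_real_derivative k * g x) (at x)"
    and init: "f s = g s" "A s = B s"
  shows "f t = g t"
proof -
  have nz: "f x \<noteq> 0" "g x \<noteq> 0" if "x \<in> {s..t}" for x using pos[OF that] by auto
  have bdd: "\<exists>K. \<forall>x \<in> {s..t}. \<bar>h x\<bar> \<le> K" if "continuous_on {s..t} h" for h :: "real \<Rightarrow> real"
    using compact_imp_bounded[OF compact_continuous_image[OF that compact_Icc]]
    by (auto simp: bounded_real)
  have "continuous_on {s..t} (\<lambda>x. 1 / f x)" "continuous_on {s..t} (\<lambda>x. B x / (f x * g x))"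
    by (intro continuous_intros cont; use nz in auto)+
  from this[THEN bdd] obtain M N where M: "\<And>x. x \<in> {s..t} \<Longrightarrow> \<bar>1 / f x\<bar> \<le> M"
    and N: "\<And>x. x \<in> {s..t} \<Longrightarrow> \<bar>B x / (f x * g x)\<bar> \<le> N"
    by blast
  define C where "C = M + \<bar>k\<bar> + 2 * N"
  define E where "E = (\<lambda>x. (f x - g x)\<^sup>2 + (A x - B x)\<^sup>2)"
  define W where "W = (\<lambda>x. exp (- C * x) * E x)"
  have "W t \<le> W s"
  proof (rule DERIV_nonpos_imp_decreasing_open[OF \<open>s \<le> t\<close>])
    show "continuous_on {s..t} W" unfolding W_def E_def by (intro continuous_intros cont)
    fix x assume x: "s < x" "x < t"
    then have xin: "x \<in> {s..t}" by simp
    define d where "d = f x - g x"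
    define e where "e = A x - B x"
    define d' where "d' = e / f x - d * (B x / (f x * g x))"
    have "A x / f x - x - (B x / g x - x) = d'"
      using nz[OF xin] by (simp add: d'_def d_def e_def field_simps)
    then have Dd: "((\<lambda>x. f x - g x) has_real_derivative d') (at x)"
      using DERIV_diff[OF f(1)[OF x] g(1)[OF x]] by simp
    have De: "((\<lambda>x. A x - B x) has_real_derivative k * d) (at x)"
      using DERIV_diff[OF f(2)[OF x] g(2)[OF x]] by (simp add: d_def algebra_simps)
    have DE: "(W has_real_derivative exp (- C * x) * (2 * d * d' + 2 * e * (k * d) - C * E x)) (at x)"
      unfolding W_def E_def
      by (rule derivative_eq_intros Dd De refl | simp add: d_def e_def algebra_simps)+
    have de: "2 * \<bar>d * e\<bar> \<le> E x"
      using sum_squares_bound[of "\<bar>d\<bar>" "\<bar>e\<bar>"] by (simp add: E_def d_def e_def abs_mult)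
    have E0: "0 \<le> E x" "d\<^sup>2 \<le> E x" by (auto simp: E_def d_def)
    have "2 * d * d' = (2 * (d * e)) * (1 / f x) - 2 * d\<^sup>2 * (B x / (f x * g x))"
      by (simp add: d'_def algebra_simps power2_eq_square)
    also have "\<dots> \<le> \<bar>2 * (d * e)\<bar> * \<bar>1 / f x\<bar> + 2 * d\<^sup>2 * \<bar>B x / (f x * g x)\<bar>"
    proof -
      have "(2 * (d * e)) * (1 / f x) \<le> \<bar>2 * (d * e)\<bar> * \<bar>1 / f x\<bar>"
        unfolding abs_mult[symmetric] by (rule abs_ge_self)
      moreover have "2 * d\<^sup>2 * (- (B x / (f x * g x))) \<le> 2 * d\<^sup>2 * \<bar>B x / (f x * g x)\<bar>"
        by (intro mult_left_mono abs_ge_minus_self) auto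
      ultimately show ?thesis by simp
    qed
    also have "\<dots> \<le> E x * M + 2 * E x * N"
      using M[OF xin] N[OF xin] de E0 by (intro add_mono mult_mono) (auto simp: abs_mult)
    finally have 1: "2 * d * d' \<le> E x * M + 2 * E x * N" .
    have "2 * e * (k * d) = k * (2 * (d * e))" by simp
    also have "\<dots> \<le> \<bar>k\<bar> * \<bar>2 * (d * e)\<bar>" unfolding abs_mult[symmetric] by (rule abs_ge_self)
    also have "\<dots> \<le> \<bar>k\<bar> * E x" using de by (intro mult_left_mono) (auto simp: abs_mult)
    finally have "2 * d * d' + 2 * e * (k * d) - C * E x \<le> 0"
      using 1 by (simp add: C_def algebra_simps)
    then show "\<exists>y. (W has_real_derivative y) (at x) \<and> y \<le> 0"
      using DE by (intro exI conjI) (auto intro: mult_nonneg_nonpos)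
  qed
  then have "E t \<le> 0" using init by (simp add: W_def E_def mult_le_0_iff)
  then have "(f t - g t)\<^sup>2 \<le> 0" unfolding E_def by (smt (verit) zero_le_power2)
  then show ?thesis by simp
qed

lemma uniqueness_of_pos:
  assumes f: "cauchy_solution m a b f" and g: "cauchy_solution m a c g" and "0 < a"
    and t: "- a < t" "ereal t < b" "ereal t < c"
    and pos: "\<And>x. - a < x \<Longrightarrow> x \<le> t \<Longrightarrow> 0 < f x" "\<And>x. - a < x \<Longrightarrow> x \<le> t \<Longrightarrow> 0 < g x"
  shows "f t = g t"
proof -
  obtain d where d: "0 < d" "\<And>x. - a < x \<Longrightarrow> x < - a + d \<Longrightarrow> f x = g x"
    using local_uniqueness[OF f g \<open>0 < a\<close>] by metis
  define s where "s = min t (- a + d / 2)"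
  have s: "- a < s" "s \<le> t" "s < - a + d" using d(1) t(1) by (auto simp: s_def)
  have dom: "ereal x < b" "ereal x < c" if "x \<le> t" for x
    using that t by (metis ereal_less_eq(3) le_less_trans)+
  have F: "(f has_real_derivative deriv f x) (at x)"
    "(flux f has_real_derivative ode_coeff m * f x) (at x)"
    and G: "(g has_real_derivative deriv g x) (at x)"
    "(flux g has_real_derivative ode_coeff m * g x) (at x)" if "- a < x" "x \<le> t" for x
    using that dom[of x] cauchy_solutionD(2,3)[OF f] cauchy_solutionD(2,3)[OF g] by auto
  have dv: "deriv h x = flux h x / h x - x" if "0 < h x" for h x
    using that by (simp add: flux_def field_simps)
  have "eventually (\<lambda>x. f x = g x) (nhds s)"
    using eventually_nhds_in_open[of "{- a<..<- a + d}" s] s d(2)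
    by (auto elim!: eventually_mono)
  then have init: "f s = g s" "deriv f s = deriv g s"
    by (auto intro: deriv_cong_ev dest: eventually_nhds_x_imp_x)
  show ?thesis
  proof (rule regular_uniqueness[OF s(2), where A = "flux f" and B = "flux g" and k = "ode_coeff m"])
    show "flux f s = flux g s" using init by (simp add: flux_def)
    have "isCont f x" "isCont g x" "isCont (flux f) x" "isCont (flux g) x" if "x \<in> {s..t}" for x
      using that s F[of x] G[of x] by (auto dest: DERIV_isCont)
    then show "continuous_on {s..t} f" "continuous_on {s..t} g"
      "continuous_on {s..t} (flux f)" "continuous_on {s..t} (flux g)"
      by (auto intro: continuous_at_imp_continuous_on)
    fix x
    show "0 < f x" "0 < g x" if "x \<in> {s..t}" using that s pos by auto
    assume x: "s < x" "x < t"
    then have "0 < f x" "0 < g x" using s pos by auto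
    then show "(f has_real_derivative flux f x / f x - x) (at x)"
      "(g has_real_derivative flux g x / g x - x) (at x)"
      using x s F(1) G(1) by (auto simp flip: dv)
    show "(flux f has_real_derivative ode_coeff m * f x) (at x)"
      "(flux g has_real_derivative ode_coeff m * g x) (at x)"
      using x s F(2) G(2) by auto
  qed (use init in auto)
qed

text \<open>
  For a vanishing coefficient the flux is constant, hence \<open>0\<close>, and \<open>f * (f' + x) = 0\<close>. So \<open>f\<close>
  follows the parabola as long as it does not vanish, that is, up to \<open>x = a\<close>. This is the only place
  where a solution can cross zero: being differentiable at \<open>a\<close>, \<open>f\<close> has there the slope \<open>- a\<close> of
  the parabola, hence is negative just after \<open>a\<close> and again follows the parabola.
\<close>

lemma solution_zero_coeff:
  assumes sol: "cauchy_solution m a b f" and "0 < a" and k: "ode_coeff m = 0"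
    and t: "- a < t" "ereal t < b"
  shows "f t = (a\<^sup>2 - t\<^sup>2) / 2"
proof -
  define q where "q = (\<lambda>x. (a\<^sup>2 - x\<^sup>2) / 2)"
  have dom: "ereal x < b" if "x \<le> t" for x
    using that t(2) by (metis ereal_less_eq(3) le_less_trans)
  have D: "(f has_real_derivative deriv f x) (at x)" if "- a < x" "x \<le> t" for x
    using cauchy_solutionD(2)[OF sol] that dom by auto
  then have cont: "isCont f x" if "- a < x" "x \<le> t" for x
    using that DERIV_isCont by blast
  have Dq: "(q has_real_derivative - x) (at x)" for x
    unfolding q_def by (auto intro!: derivative_eq_intros)
  have slope: "deriv f x = - x" if x: "- a < x" "x < t" and "f x \<noteq> 0" for x
  proof -
    have "\<bar>flux f x\<bar> \<le> 0 * (x - - a)"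
      by (rule abs_le_of_deriv_bound[OF x, of _ "\<lambda>_. 0"])
         (use cauchy_solutionD(3)[OF sol] dom k flux_tendsto_0[OF sol] in auto)
    then have "f x * (deriv f x + x) = 0" by (simp add: flux_def algebra_simps)
    then show ?thesis using \<open>f x \<noteq> 0\<close> by simp
  qed
  have extend: "f z = q z"
    if "- a \<le> p" "p < z" "z \<le> t" "\<And>x. p < x \<Longrightarrow> x < z \<Longrightarrow> f x \<noteq> 0"
      "(f \<longlongrightarrow> q p) (at_right p)" for p z
  proof -
    have "((\<lambda>x. f x - q x) \<longlongrightarrow> q p - q p) (at_right p)"
      using that(5) DERIV_isCont[OF Dq]
      by (intro tendsto_intros) (auto simp: isCont_def filterlim_at_split)
    moreover have "((\<lambda>x. f x - q x) has_real_derivative 0) (at x)" if "p < x" "x < z" for x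
      using DERIV_diff[OF D Dq, of x] slope[of x] that \<open>- a \<le> p\<close> \<open>z \<le> t\<close>
        \<open>\<And>x. p < x \<Longrightarrow> x < z \<Longrightarrow> f x \<noteq> 0\<close> by auto
    moreover have "isCont (\<lambda>x. f x - q x) z"
      using that by (intro continuous_intros cont DERIV_isCont[OF Dq]) auto
    ultimately show ?thesis
      using mvt_right[OF \<open>p < z\<close>, of "\<lambda>x. f x - q x" "\<lambda>_. 0" 0] by auto
  qed
  have start: "(f \<longlongrightarrow> q (- a)) (at_right (- a))"
    using cauchy_solutionD(4)[OF sol] by (simp add: q_def)
  have before: "f z = q z" if "- a < z" "z \<le> t" "z \<le> a" for z
  proof (cases "\<exists>y. - a < y \<and> y < z \<and> f y \<le> 0")
    case True
    then obtain y where y: "- a < y" "y < z" "f y \<le> 0" by blast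
    obtain z0 where z0: "- a < z0" "z0 \<le> y" "f z0 = 0" "\<And>x. - a < x \<Longrightarrow> x < z0 \<Longrightarrow> 0 < f x"
    proof (rule first_zero[OF cauchy_solution_eventually_pos[OF sol \<open>0 < a\<close>] _ y(1,3)])
      show "isCont f x" if "- a < x" "x \<le> y" for x
        using cont that y(2) \<open>z \<le> t\<close> by simp
    qed (rule that)
    have "f z0 = q z0"
    proof (rule extend[OF order_refl z0(1) _ _ start])
      show "z0 \<le> t" using z0(2) y(2) that(2) by linarith
      show "f x \<noteq> 0" if "- a < x" "x < z0" for x using z0(4)[OF that] by simp
    qed
    then have "q z0 = 0" using z0(3) by simp
    then have "z0\<^sup>2 = a\<^sup>2" by (simp add: q_def)
    then have "z0 = a" using z0(1) by (simp add: power2_eq_iff)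
    then show ?thesis using z0(2) y(2) that(3) by simp
  next
    case False
    then have "f x \<noteq> 0" if "- a < x" "x < z" for x using that by force
    then show ?thesis by (intro extend[OF order_refl that(1,2) _ start])
  qed
  show ?thesis
  proof (cases "t \<le> a")
    case True
    then show ?thesis using before[of t] t by (simp add: q_def)
  next
    case False
    then have "a < t" by simp
    have fa: "f a = 0" using before[of a] \<open>a < t\<close> \<open>0 < a\<close> by (simp add: q_def)
    have Dh: "((\<lambda>x. f x - q x) has_real_derivative deriv f a + a) (at a)"
      using DERIV_diff[OF D Dq, of a] \<open>0 < a\<close> \<open>a < t\<close> by simp
    have left: "\<exists>h>0. h < e \<and> f (a - h) - q (a - h) = f a - q a" if "0 < e" for e :: real
      using before[of a] before[of "a - min (e / 2) a"] that \<open>0 < a\<close> \<open>a < t\<close>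
      by (intro exI[of _ "min (e / 2) a"]) (auto simp: min_def)
    have "\<not> 0 < deriv f a + a"
      using DERIV_pos_inc_left[OF Dh] left by force
    moreover have "\<not> deriv f a + a < 0"
      using DERIV_neg_dec_left[OF Dh] left by force
    ultimately have "deriv f a = - a" by simp
    then have "(f has_real_derivative - a) (at a)" using D[of a] \<open>0 < a\<close> \<open>a < t\<close> by simp
    then obtain e where "0 < e" and decr: "\<And>h. 0 < h \<Longrightarrow> h < e \<Longrightarrow> f (a + h) < f a"
      using DERIV_neg_dec_right[of f "- a" a] \<open>0 < a\<close> by auto
    then have neg: "eventually (\<lambda>x. 0 < - f x) (at_right a)"
      unfolding eventually_at_right_field
    proof (intro exI[of _ "a + e"] conjI allI impI)
      show "0 < - f x" if "a < x" "x < a + e" for x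
        using decr[of "x - a"] that fa by simp
    qed (use \<open>0 < e\<close> in simp)
    have fa_lim: "(f \<longlongrightarrow> q a) (at_right a)"
      using cont[of a] \<open>0 < a\<close> \<open>a < t\<close> fa by (simp add: isCont_def filterlim_at_split q_def)
    \<comment> \<open>A negative piece of the parabola right of \<open>a\<close> never returns to zero.\<close>
    have after: "f y < 0" if y: "a < y" "y \<le> t" for y
    proof (rule ccontr)
      assume "\<not> f y < 0"
      then have "- f y \<le> 0" by simp
      obtain z where z: "a < z" "z \<le> y" "- f z = 0" "\<And>x. a < x \<Longrightarrow> x < z \<Longrightarrow> 0 < - f x"
      proof (rule first_zero[OF neg _ y(1) \<open>- f y \<le> 0\<close>])
        show "isCont (\<lambda>x. - f x) x" if "a < x" "x \<le> y" for x
          using that \<open>y \<le> t\<close> \<open>0 < a\<close> by (intro continuous_intros cont) auto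
      qed (rule that)
      have "f z = q z"
      proof (rule extend[OF _ z(1) _ _ fa_lim])
        show "f x \<noteq> 0" if "a < x" "x < z" for x using z(4)[OF that] by simp
      qed (use z(2) y \<open>0 < a\<close> in auto)
      moreover have "a\<^sup>2 < z\<^sup>2"
        using z(1) \<open>0 < a\<close> by (intro power_strict_mono) auto
      ultimately show False using z(3) by (simp add: q_def)
    qed
    have "f t = q t"
    proof (rule extend[OF _ \<open>a < t\<close> order_refl _ fa_lim])
      show "f x \<noteq> 0" if "a < x" "x < t" for x using after[of x] that by simp
    qed (use \<open>0 < a\<close> in auto)
    then show ?thesis by (simp add: q_def)
  qed
qed

theorem cauchy_solution_unique:
  assumes f: "cauchy_solution m a b f" and g: "cauchy_solution m a c g" and "0 < a"
    and t: "- a < t" "ereal t < b" "ereal t < c"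
  shows "f t = g t"
proof (cases "ode_coeff m = 0")
  case True
  then show ?thesis using solution_zero_coeff f g t \<open>0 < a\<close> by metis
next
  case False
  have dom: "ereal x < b" "ereal x < c" if "x \<le> t" for x
    using that t by (metis ereal_less_eq(3) le_less_trans)+
  show ?thesis
    by (rule uniqueness_of_pos[OF f g \<open>0 < a\<close> t])
       (use cauchy_solution_pos[OF f \<open>0 < a\<close> False] cauchy_solution_pos[OF g \<open>0 < a\<close> False] dom
        in auto)
qed

section \<open>The power series\<close>

text \<open>
  The substitution of \<open>n - i\<close> for \<open>i\<close> shows that the weight \<open>i\<close> may be replaced by its mean
  \<open>n / 2\<close>. This reconciles the asymmetric weights \<open>l * (k + 3) + 1\<close> of the recursion with the
  coefficients of \<open>f * f'\<close>.
\<close>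

lemma sum_linear_weight_convolution:
  fixes u :: "nat \<Rightarrow> real"
  shows "(\<Sum>i\<le>n. (\<alpha> + \<beta> * real i) * u i * u (n - i)) = (\<alpha> + \<beta> * real n / 2) * (\<Sum>i\<le>n. u i * u (n - i))"
proof -
  define T where "T = (\<Sum>i\<le>n. real i * (u i * u (n - i)))"
  define S where "S = (\<Sum>i\<le>n. u i * u (n - i))"
  have "T = (\<Sum>i\<le>n. real (n - i) * (u (n - i) * u (n - (n - i))))"
    unfolding T_def by (rule sum.nat_diff_reindex[symmetric, of _ "Suc n", simplified lessThan_Suc_atMost diff_Suc_Suc])
  also have "\<dots> = (\<Sum>i\<le>n. real n * (u i * u (n - i)) - real i * (u i * u (n - i)))"
    by (intro sum.cong) (auto simp: of_nat_diff algebra_simps)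
  also have "\<dots> = real n * S - T"
    by (simp add: T_def S_def sum_subtractf sum_distrib_left)
  finally have "T = real n / 2 * S" by simp
  moreover have "(\<Sum>i\<le>n. (\<alpha> + \<beta> * real i) * u i * u (n - i)) = \<alpha> * S + \<beta> * T"
    by (simp add: T_def S_def sum_distrib_left algebra_simps flip: sum.distrib)
  ultimately show ?thesis by (simp add: S_def algebra_simps)
qed

lemma chi_0 [simp]: "chi m 0 = 0"
  by (simp add: chi.simps)

lemma chi_1:
  assumes "m \<noteq> 0" "m \<noteq> - \<infinity>"
  shows "chi m (Suc 0) = (ode_coeff m - 2) / 4"
proof (cases m)
  case (real r)
  then have "r \<noteq> 0" using assms by auto
  then show ?thesis using real by (simp add: chi.simps[of _ "Suc 0"] ode_coeff_def field_simps)
qed (use assms in \<open>simp_all add: chi.simps[of _ "Suc 0"] ode_coeff_def\<close>)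

text \<open>
  The value \<open>chi m 0 = 0\<close> allows the sum to run over all of \<open>{..k}\<close>, and expressing the factor of
  \<open>chi m (k - 1)\<close> by \<open>ode_coeff m\<close> covers \<open>m = \<infinity>\<close> together with the finite case.
\<close>

lemma chi_rec:
  assumes "m \<noteq> 0" "m \<noteq> - \<infinity>" and "2 \<le> k"
  shows "(real k + 1)\<^sup>2 * chi m k = (ode_coeff m - real k - 1) * chi m (k - 1)
    - (\<Sum>l\<le>k. (1 + (real k + 3) * real l) * chi m l * chi m (k - l))"
proof -
  have coeff: "- chi m (k - 1) * (case m of ereal r \<Rightarrow> (1 + r * real (k - 1)) / r | _ \<Rightarrow> real (k - 1))
      = (ode_coeff m - real k - 1) * chi m (k - 1)"
  proof (cases m)
    case (real r)
    then have "r \<noteq> 0" using assms by auto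
    then show ?thesis using real assms(3) by (simp add: ode_coeff_def of_nat_diff field_simps)
  qed (use assms in \<open>simp_all add: ode_coeff_def of_nat_diff algebra_simps\<close>)
  have "(\<Sum>l\<le>k. (1 + (real k + 3) * real l) * chi m l * chi m (k - l))
      = (\<Sum>l = 1..k - 1. (1 + (real k + 3) * real l) * chi m l * chi m (k - l))"
  proof (intro sum.mono_neutral_right ballI)
    fix l assume "l \<in> {..k} - {1..k - 1}"
    then have "l = 0 \<or> l = k" by auto
    then show "(1 + (real k + 3) * real l) * chi m l * chi m (k - l) = 0" by auto
  qed auto
  also have "\<dots> = (\<Sum>l = 1..k - 1. real (l * (k + 3) + 1) * chi m l * chi m (k - l))"
    by (intro sum.cong) (auto simp: algebra_simps)
  finally show ?thesis
    using assms(3) by (subst (1) chi.simps) (simp add: coeff[simplified])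
qed

lemma chi_bound:
  assumes "m \<noteq> 0" "m \<noteq> - \<infinity>" and "2 \<le> k"
  shows "\<bar>chi m k\<bar> \<le> (\<bar>ode_coeff m\<bar> + 1) * \<bar>chi m (k - 1)\<bar> + (\<Sum>l\<le>k. \<bar>chi m l\<bar> * \<bar>chi m (k - l)\<bar>)"
proof -
  have "(\<Sum>l\<le>k. \<bar>(1 + (real k + 3) * real l) * chi m l * chi m (k - l)\<bar>)
      \<le> (\<Sum>l\<le>k. (real k + 1)\<^sup>2 * (\<bar>chi m l\<bar> * \<bar>chi m (k - l)\<bar>))"
  proof (rule sum_mono)
    fix l assume "l \<in> {..k}"
    show "\<bar>(1 + (real k + 3) * real l) * chi m l * chi m (k - l)\<bar>
      \<le> (real k + 1)\<^sup>2 * (\<bar>chi m l\<bar> * \<bar>chi m (k - l)\<bar>)"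
    proof (cases "l = k")
      case False
      with \<open>l \<in> {..k}\<close> have "real l \<le> real k - 1" by auto
      then have "1 + (real k + 3) * real l \<le> 1 + (real k + 3) * (real k - 1)"
        by (intro add_left_mono mult_left_mono) auto
      also have "\<dots> \<le> (real k + 1)\<^sup>2" by (simp add: power2_eq_square algebra_simps)
      finally have "1 + (real k + 3) * real l \<le> (real k + 1)\<^sup>2" .
      then show ?thesis
        by (simp add: abs_mult mult.assoc mult_right_mono)
    qed simp
  qed
  then have conv: "\<bar>\<Sum>l\<le>k. (1 + (real k + 3) * real l) * chi m l * chi m (k - l)\<bar>
      \<le> (real k + 1)\<^sup>2 * (\<Sum>l\<le>k. \<bar>chi m l\<bar> * \<bar>chi m (k - l)\<bar>)"
    by (simp only: sum_distrib_left) (erule order_trans[OF sum_abs])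
  have "\<bar>ode_coeff m - real k - 1\<bar> \<le> \<bar>ode_coeff m\<bar> + (real k + 1)" by simp
  also have "\<dots> \<le> (real k + 1) * (\<bar>ode_coeff m\<bar> + 1)"
    by (simp add: algebra_simps mult_nonneg_nonneg)
  also have "\<dots> \<le> (real k + 1)\<^sup>2 * (\<bar>ode_coeff m\<bar> + 1)"
    by (intro mult_right_mono) (auto simp: power2_eq_square)
  finally have "\<bar>(ode_coeff m - real k - 1) * chi m (k - 1)\<bar>
      \<le> (real k + 1)\<^sup>2 * ((\<bar>ode_coeff m\<bar> + 1) * \<bar>chi m (k - 1)\<bar>)"
    by (simp add: abs_mult mult_right_mono flip: mult.assoc)
  with conv have "\<bar>(real k + 1)\<^sup>2 * chi m k\<bar> \<le> (real k + 1)\<^sup>2 *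
      ((\<bar>ode_coeff m\<bar> + 1) * \<bar>chi m (k - 1)\<bar> + (\<Sum>l\<le>k. \<bar>chi m l\<bar> * \<bar>chi m (k - l)\<bar>))"
    unfolding chi_rec[OF assms] distrib_left by linarith
  then have "(real k + 1)\<^sup>2 * \<bar>chi m k\<bar> \<le> (real k + 1)\<^sup>2 *
      ((\<bar>ode_coeff m\<bar> + 1) * \<bar>chi m (k - 1)\<bar> + (\<Sum>l\<le>k. \<bar>chi m l\<bar> * \<bar>chi m (k - l)\<bar>))"
    by (simp add: abs_mult)
  then show ?thesis by (rule mult_left_le_imp_le) auto
qed

text \<open>
  As \<open>p 0 = 0\<close>, a nonzero product \<open>p i * p j\<close> with \<open>i + j \<le> Suc n\<close> has both indices at most \<open>n\<close>.
  The square therefore involves only earlier partial sums, which permits an induction on \<open>n\<close>.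
\<close>

lemma convolution_sum_le_square:
  fixes p :: "nat \<Rightarrow> real"
  assumes "p 0 = 0" "\<And>k. 0 \<le> p k"
  shows "(\<Sum>k\<le>Suc n. \<Sum>i\<le>k. p i * p (k - i)) \<le> (\<Sum>k\<le>n. p k)\<^sup>2"
proof -
  have fin: "finite {(i, j). i + j \<le> Suc n}"
    by (rule finite_subset[of _ "{..Suc n} \<times> {..Suc n}"]) auto
  have "(\<Sum>k\<le>Suc n. \<Sum>i\<le>k. p i * p (k - i)) = (\<Sum>(i, j) | i + j \<le> Suc n. p i * p j)"
    by (rule sum.triangle_reindex_eq[symmetric])
  also have "\<dots> = (\<Sum>(i, j) | i + j \<le> Suc n \<and> 0 < i \<and> 0 < j. p i * p j)"
    using fin assms(1) by (intro sum.mono_neutral_right) (auto intro: gr0I)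
  also have "\<dots> \<le> (\<Sum>(i, j) \<in> {..n} \<times> {..n}. p i * p j)"
    using assms(2) by (intro sum_mono2) auto
  also have "\<dots> = (\<Sum>k\<le>n. p k)\<^sup>2"
    by (simp add: power2_eq_square sum_product sum.cartesian_product)
  finally show ?thesis .
qed

text \<open>
  Let \<open>X n\<close> be the sum of \<open>\<bar>chi m k\<bar> * e ^ k\<close> over \<open>k \<le> n\<close>. The recursion gives
  \<open>X (n + 1) \<le> \<bar>chi m 1\<bar> * e + \<alpha> * e * X n + (X n)\<^sup>2\<close> with \<open>\<alpha> = \<bar>ode_coeff m\<bar> + 1\<close>, and for small
  \<open>e\<close> the right-hand side does not exceed \<open>1 / 4\<close> when \<open>X n\<close> does not. So all partial sums are
  bounded by \<open>1 / 4\<close>, and the radius of convergence is at least \<open>e\<close>.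
\<close>

lemma chi_geometric_bound:
  assumes "m \<noteq> 0" "m \<noteq> - \<infinity>"
  obtains e where "0 < e" "\<And>k. \<bar>chi m k\<bar> * e ^ k \<le> 1"
proof -
  define \<alpha> where "\<alpha> = \<bar>ode_coeff m\<bar> + 1"
  define e where "e = 1 / (8 * (\<bar>chi m 1\<bar> + \<alpha>))"
  have "0 < \<alpha>" by (simp add: \<alpha>_def)
  then have "0 < e" and e: "\<bar>chi m 1\<bar> * e + \<alpha> * e \<le> 1 / 8"
    by (auto simp: e_def field_simps)
  define p where "p = (\<lambda>k. \<bar>chi m k\<bar> * e ^ k)"
  have p: "p 0 = 0" "\<And>k. 0 \<le> p k" using \<open>0 < e\<close> by (auto simp: p_def)
  have step: "p (Suc k) \<le> (if k = 0 then \<bar>chi m 1\<bar> * e else 0) + \<alpha> * e * p k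
      + (\<Sum>i\<le>Suc k. p i * p (Suc k - i))" for k
  proof (cases "k = 0")
    case True
    then show ?thesis using p by (simp add: p_def)
  next
    case False
    then have "\<bar>chi m (Suc k)\<bar> * e ^ Suc k \<le>
        (\<alpha> * \<bar>chi m k\<bar> + (\<Sum>l\<le>Suc k. \<bar>chi m l\<bar> * \<bar>chi m (Suc k - l)\<bar>)) * e ^ Suc k"
      using chi_bound[OF assms, of "Suc k"] \<open>0 < e\<close> by (intro mult_right_mono) (auto simp: \<alpha>_def)
    also have "\<dots> = \<alpha> * e * p k + (\<Sum>i\<le>Suc k. p i * p (Suc k - i))"
    proof -
      have "\<bar>chi m l\<bar> * \<bar>chi m (Suc k - l)\<bar> * e ^ Suc k = p l * p (Suc k - l)" if "l \<le> Suc k" for l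
        using power_add[of e l "Suc k - l"] that by (simp add: p_def del: power_Suc)
      then have "(\<Sum>l\<le>Suc k. \<bar>chi m l\<bar> * \<bar>chi m (Suc k - l)\<bar> * e ^ Suc k) = (\<Sum>i\<le>Suc k. p i * p (Suc k - i))"
        by (intro sum.cong) auto
      then show ?thesis
        by (simp only: distrib_right sum_distrib_right) (simp add: p_def)
    qed
    finally show ?thesis using False by (simp add: p_def)
  qed
  have "(\<Sum>k\<le>n. p k) \<le> 1 / 4" for n
  proof (induction n)
    case (Suc n)
    have "(\<Sum>k\<le>Suc n. p k) = (\<Sum>k\<le>n. p (Suc k))"
      using p(1) sum.atMost_Suc_shift[of p n] by simp
    also have "\<dots> \<le> (\<Sum>k\<le>n. (if k = 0 then \<bar>chi m 1\<bar> * e else 0) + \<alpha> * e * p k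
      + (\<Sum>i\<le>Suc k. p i * p (Suc k - i)))"
      by (intro sum_mono step)
    also have "\<dots> = \<bar>chi m 1\<bar> * e + \<alpha> * e * (\<Sum>k\<le>n. p k) + (\<Sum>k\<le>Suc n. \<Sum>i\<le>k. p i * p (k - i))"
      using p(1) sum.atMost_Suc_shift[of "\<lambda>k. \<Sum>i\<le>k. p i * p (k - i)" n]
      by (simp add: sum.distrib sum_distrib_left)
    also have "\<dots> \<le> \<bar>chi m 1\<bar> * e + \<alpha> * e * 1 + (1 / 4)\<^sup>2"
    proof (intro add_mono mult_left_mono order_refl)
      show "(\<Sum>k\<le>n. p k) \<le> 1" using Suc.IH by simp
      show "(\<Sum>k\<le>Suc n. \<Sum>i\<le>k. p i * p (k - i)) \<le> (1 / 4)\<^sup>2"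
        using convolution_sum_le_square[of p n, OF p] power_mono[OF Suc.IH, of 2]
          sum_nonneg[of "{..n}" p] p(2) by (meson order_trans)
    qed (use \<open>0 < e\<close> \<open>0 < \<alpha>\<close> in auto)
    also have "\<dots> \<le> 1 / 4" using e by (simp add: power2_eq_square)
    finally show ?case .
  qed (use p in auto)
  moreover have "p k \<le> (\<Sum>k\<le>k. p k)" for k
    using p(2) by (intro member_le_sum) auto
  ultimately have "p k \<le> 1 / 4" for k by (rule order_trans[rotated])
  then have "p k \<le> 1" for k by (rule order_trans) simp
  then show thesis using that[OF \<open>0 < e\<close>] by (simp add: p_def)
qed

text \<open>
  The bracket in the expansion of the solution, as a power series in \<open>(\<Phi> + a) / a\<close>. Since
  \<open>chi m 0 = 0\<close>, the constant term \<open>1\<close> is added separately.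
\<close>

definition chi_fps :: "ereal \<Rightarrow> 'a :: real_normed_field fps" where
  "chi_fps m = 1 + Abs_fps (\<lambda>k. of_real (chi m k))"

text \<open>
  In the scaled variables \<open>w = (\<Phi> + a) / a\<close> and \<open>f / a\<^sup>2\<close> the parameter \<open>a\<close> disappears; this is
  the series of \<open>f / a\<^sup>2\<close> in \<open>w\<close>.
\<close>

definition profile_fps :: "ereal \<Rightarrow> real fps" where
  "profile_fps m = fps_X * chi_fps m"

lemma chi_fps_nth: "fps_nth (chi_fps m) k = (if k = 0 then 1 else of_real (chi m k))"
  by (simp add: chi_fps_def)

text \<open>
  The equation in the scaled variables, where \<open>\<Phi> / a\<close> is \<open>fps_X - 1\<close>. Comparing coefficients
  gives, with \<open>c 0 = 1\<close> and \<open>c k = chi m k\<close> otherwise, the relation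
  \<open>(n + 1) * ((n / 2 + 1) * (\<Sum>i\<le>n. c i * c (n - i)) + c (n - 1) - c n) = ode_coeff m * c (n - 1)\<close>,
  where \<open>c (n - 1)\<close> stands for \<open>0\<close> if \<open>n = 0\<close>.
  Splitting off the two terms of the sum that contain \<open>c n\<close> turns it into the recursion for \<open>chi\<close>.
\<close>

lemma profile_fps_ode:
  assumes "m \<noteq> 0" "m \<noteq> - \<infinity>"
  defines "H \<equiv> profile_fps m"
  shows "fps_deriv (H * fps_deriv H + (fps_X - 1) * H) = fps_const (ode_coeff m) * H"
proof (rule fps_ext)
  fix n
  define c where "c = (\<lambda>k. if k = 0 then 1 else chi m k)"
  have G: "fps_nth (chi_fps m :: real fps) k = c k" for k
    by (simp add: chi_fps_nth c_def)
  have H: "fps_nth H (Suc k) = c k" "fps_nth H 0 = 0" for k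
    by (simp_all add: H_def profile_fps_def G)
  have "fps_nth (H * fps_deriv H) (Suc n) = fps_nth (chi_fps m * fps_deriv H) n"
    unfolding H_def profile_fps_def by (simp only: mult.assoc fps_X_mult_nth) simp
  also have "\<dots> = (\<Sum>i\<le>n. (real n + 1 + (- 1) * real i) * c i * c (n - i))"
    unfolding fps_mult_nth atLeast0AtMost
    by (intro sum.cong) (auto simp: G H of_nat_diff algebra_simps)
  also have "\<dots> = (real n / 2 + 1) * (\<Sum>i\<le>n. c i * c (n - i))"
    unfolding sum_linear_weight_convolution by (simp add: algebra_simps)
  finally have HH: "fps_nth (H * fps_deriv H) (Suc n) = (real n / 2 + 1) * (\<Sum>i\<le>n. c i * c (n - i))" .
  have lhs: "fps_nth (fps_deriv (H * fps_deriv H + (fps_X - 1) * H)) n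
    = (real n + 1) * ((real n / 2 + 1) * (\<Sum>i\<le>n. c i * c (n - i)) + fps_nth H n - c n)"
  proof -
    have "fps_nth ((fps_X - 1) * H) (Suc n) = fps_nth H n - c n"
      by (simp add: left_diff_distrib H)
    then show ?thesis
      by (simp only: fps_deriv_nth fps_add_nth HH Suc_eq_plus1[symmetric]) (simp add: add_diff_eq add.commute)
  qed
  show "fps_nth (fps_deriv (H * fps_deriv H + (fps_X - 1) * H)) n = fps_nth (fps_const (ode_coeff m) * H) n"
  proof (cases n)
    case 0
    then show ?thesis unfolding lhs by (simp add: H c_def)
  next
    case (Suc k)
    \<comment> \<open>The two end terms of the convolution contain the new coefficient.\<close>
    have "(\<Sum>i\<le>n. c i * c (n - i)) = 2 * chi m n + (\<Sum>i\<le>n. chi m i * chi m (n - i))"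
    proof -
      have "(\<Sum>i\<le>n. c i * c (n - i)) = (\<Sum>i\<le>n. (if i = 0 then chi m n else 0)
          + (if i = n then chi m n else 0) + chi m i * chi m (n - i))"
        using Suc by (intro sum.cong) (auto simp: c_def)
      then show ?thesis by (simp add: sum.distrib)
    qed
    moreover have "(real n + 1)\<^sup>2 * chi m n = (ode_coeff m - real n - 1) * c k
      - (real n + 1) * (real n / 2 + 1) * (\<Sum>i\<le>n. chi m i * chi m (n - i))"
    proof (cases "k = 0")
      case True
      then show ?thesis using Suc chi_1[OF assms(1,2)] by (simp add: c_def)
    next
      case False
      have "1 + (real n + 3) * real n / 2 = (real n + 1) * (real n / 2 + 1)"
        by (simp add: field_simps)
      then show ?thesis
        using chi_rec[OF assms(1,2), of n] Suc False
        unfolding sum_linear_weight_convolution by (simp add: c_def)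
    qed
    moreover have "c n = chi m n" "fps_nth H n = c k" using Suc by (simp_all add: c_def H)
    ultimately show ?thesis
      unfolding lhs by (simp add: power2_eq_square field_simps)
  qed
qed

lemma chi_fps_conv_radius:
  assumes "\<And>k. \<bar>chi m k\<bar> * e ^ k \<le> 1"
  shows "ereal e \<le> fps_conv_radius (chi_fps m :: 'a :: {banach, real_normed_field} fps)"
  unfolding fps_conv_radius_def
proof (rule conv_radius_geI_ex')
  fix r :: real assume r: "0 < r" "ereal r < ereal e"
  have "norm (fps_nth (chi_fps m :: 'a fps) k) * e ^ k \<le> 1" for k
    using assms[of k] by (simp add: chi_fps_nth)
  then have "summable (\<lambda>n. norm (fps_nth (chi_fps m :: 'a fps) n) * r ^ n)"
    using r by (intro Abel_lemma[of r e _ 1]) auto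
  then have "summable (\<lambda>n. norm (fps_nth (chi_fps m :: 'a fps) n * of_real r ^ n))"
    using r by (simp add: norm_mult norm_power)
  then show "summable (\<lambda>n. fps_nth (chi_fps m :: 'a fps) n * of_real r ^ n)"
    by (rule summable_norm_cancel)
qed

lemma profile_fps_nth: "fps_nth (profile_fps m) 0 = 0" "fps_nth (profile_fps m) (Suc 0) = 1"
  by (simp_all add: profile_fps_def chi_fps_nth)

lemma profile_fps_conv_radius:
  assumes "\<And>k. \<bar>chi m k\<bar> * e ^ k \<le> 1"
  shows "ereal e \<le> fps_conv_radius (profile_fps m)"
  using fps_conv_radius_mult[of fps_X "chi_fps m :: real fps"] chi_fps_conv_radius[OF assms, where 'a = real]
  by (simp add: profile_fps_def)

lemma eval_profile_fps:
  assumes "\<And>k. \<bar>chi m k\<bar> * e ^ k \<le> 1" "\<bar>w\<bar> < e"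
  shows "eval_fps (profile_fps m) w = w * eval_fps (chi_fps m) w"
proof -
  have "ereal (norm w) < fps_conv_radius (chi_fps m :: real fps)"
    using chi_fps_conv_radius[OF assms(1), where 'a = real] assms(2)
    by (metis less_le_trans ereal_less(2) less_ereal.simps(1) real_norm_def)
  then show ?thesis by (simp add: profile_fps_def eval_fps_mult)
qed

lemma eval_chi_fps_of_real:
  assumes "\<And>k. \<bar>chi m k\<bar> * e ^ k \<le> 1" "\<bar>w\<bar> < e"
  shows "eval_fps (chi_fps m) (of_real w :: 'a :: {banach, real_normed_field}) = of_real (eval_fps (chi_fps m) w)"
proof -
  have "ereal (norm w) < fps_conv_radius (chi_fps m :: real fps)"
    using chi_fps_conv_radius[OF assms(1), where 'a = real] assms(2)
    by (metis less_le_trans ereal_less(2) less_ereal.simps(1) real_norm_def)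
  then have "(\<lambda>n. of_real (fps_nth (chi_fps m) n * w ^ n) :: 'a) sums of_real (eval_fps (chi_fps m) w)"
    by (intro sums_of_real sums_eval_fps)
  moreover have "(\<lambda>n. of_real (fps_nth (chi_fps m) n * w ^ n)) =
      (\<lambda>n. fps_nth (chi_fps m) n * (of_real w :: 'a) ^ n)"
    by (auto simp: chi_fps_nth)
  ultimately show ?thesis unfolding eval_fps_def[of _ "of_real w"] by (simp add: sums_iff)
qed

lemma chi_series:
  fixes w :: "'a :: {banach, real_normed_field}"
  assumes "\<And>k. \<bar>chi m k\<bar> * e ^ k \<le> 1" "norm w < e"
  shows "summable (\<lambda>k. of_real (chi m (Suc k)) * w ^ Suc k)"
    and "eval_fps (chi_fps m) w = 1 + (\<Sum>k. of_real (chi m (Suc k)) * w ^ Suc k)"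
proof -
  have "ereal (norm w) < fps_conv_radius (chi_fps m :: 'a fps)"
    using chi_fps_conv_radius[OF assms(1), where 'a = 'a] assms(2)
    by (metis less_le_trans less_ereal.simps(1))
  then have "(\<lambda>n. fps_nth (chi_fps m) n * w ^ n) sums eval_fps (chi_fps m) w"
    by (rule sums_eval_fps)
  then have "(\<lambda>n. fps_nth (chi_fps m) (Suc n) * w ^ Suc n) sums (eval_fps (chi_fps m) w - 1)"
    by (subst sums_Suc_iff) (simp add: chi_fps_nth)
  then have "(\<lambda>k. of_real (chi m (Suc k)) * w ^ Suc k) sums (eval_fps (chi_fps m) w - 1)"
    by (simp add: chi_fps_nth)
  then show "summable (\<lambda>k. of_real (chi m (Suc k)) * w ^ Suc k)"
    and "eval_fps (chi_fps m) w = 1 + (\<Sum>k. of_real (chi m (Suc k)) * w ^ Suc k)"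
    by (simp_all add: sums_iff)
qed

definition series_solution :: "ereal \<Rightarrow> real \<Rightarrow> real \<Rightarrow> real" where
  "series_solution m a x = a\<^sup>2 * eval_fps (profile_fps m) ((x + a) / a)"

text \<open>
  On its disc of convergence the evaluation of power series commutes with the ring operations and
  with differentiation, so the identity of formal series becomes the differential equation.
\<close>

lemma cauchy_solution_series:
  assumes m: "m \<noteq> 0" "m \<noteq> - \<infinity>" and "0 < a" and e: "0 < e" "\<And>k. \<bar>chi m k\<bar> * e ^ k \<le> 1"
  shows "cauchy_solution m a (ereal (- a + a * e)) (series_solution m a)"
proof -
  define H where "H = profile_fps m"
  define f where "f = series_solution m a"
  let ?w = "\<lambda>x. (x + a) / a"
  have rad: "ereal e \<le> fps_conv_radius H"
    unfolding H_def by (rule profile_fps_conv_radius[OF e(2)])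
  then have rad': "ereal e \<le> fps_conv_radius (fps_deriv H)"
    using fps_conv_radius_deriv order_trans by blast
  have radX: "ereal e \<le> fps_conv_radius (fps_X - 1 :: real fps)"
    using fps_conv_radius_diff[of "fps_X :: real fps" 1] by (simp add: order_trans[of _ \<infinity>])
  have mult: "ereal e \<le> fps_conv_radius (P * Q)"
    if "ereal e \<le> fps_conv_radius P" "ereal e \<le> fps_conv_radius Q" for P Q :: "real fps"
    using fps_conv_radius_mult[of P Q] that by (meson min.boundedI order_trans)
  have radS: "ereal e \<le> fps_conv_radius (H * fps_deriv H + (fps_X - 1) * H)"
    using fps_conv_radius_add[of "H * fps_deriv H" "(fps_X - 1) * H"] mult[OF rad rad'] mult[OF radX rad]
    by (meson min.boundedI order_trans)
  have less: "ereal (norm w) < fps_conv_radius P" if "\<bar>w\<bar> < e" "ereal e \<le> fps_conv_radius P"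
    for w :: real and P :: "real fps"
    using that by (metis less_le_trans less_ereal.simps(1) real_norm_def)
  have D: "((\<lambda>x. eval_fps P (?w x)) has_real_derivative eval_fps (fps_deriv P) (?w x) / a) (at x)"
    if "ereal e \<le> fps_conv_radius P" "\<bar>?w x\<bar> < e" for P x
  proof -
    have "(?w has_real_derivative 1 / a) (at x)"
      using \<open>0 < a\<close> by (auto intro!: derivative_eq_intros)
    then show ?thesis
      using DERIV_chain2[of "eval_fps P" "eval_fps (fps_deriv P) (?w x)" ?w x "1 / a" UNIV]
        has_field_derivative_eval_fps[OF less[OF that(2,1)]] by simp
  qed
  have Df: "(f has_real_derivative a * eval_fps (fps_deriv H) (?w x)) (at x)" if "\<bar>?w x\<bar> < e" for x
    using DERIV_cmult[OF D[OF rad that], of "a\<^sup>2"] \<open>0 < a\<close>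
    by (simp add: f_def series_solution_def[abs_def] H_def power2_eq_square)
  then have df: "deriv f x = a * eval_fps (fps_deriv H) (?w x)" if "\<bar>?w x\<bar> < e" for x
    using that DERIV_imp_deriv by blast
  have flux: "flux f x = a ^ 3 * eval_fps (H * fps_deriv H + (fps_X - 1) * H) (?w x)" if "\<bar>?w x\<bar> < e" for x
  proof -
    note l = less[OF that]
    define w where "w = ?w x"
    have x: "x = a * (w - 1)" using \<open>0 < a\<close> by (simp add: w_def field_simps)
    have S: "eval_fps (H * fps_deriv H + (fps_X - 1) * H) w
      = eval_fps H w * eval_fps (fps_deriv H) w + (w - 1) * eval_fps H w"
      unfolding w_def eval_fps_add[OF l[OF mult[OF rad rad']] l[OF mult[OF radX rad]]]
        eval_fps_mult[OF l[OF rad] l[OF rad']] eval_fps_mult[OF l[OF radX] l[OF rad]]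
      by (simp add: eval_fps_diff)
    have fx: "f x = a\<^sup>2 * eval_fps H w" "deriv f x = a * eval_fps (fps_deriv H) w"
      using df[OF that] by (simp_all add: f_def series_solution_def H_def w_def)
    have "flux f x = f x * deriv f x + a * (w - 1) * f x"
      unfolding flux_def x[symmetric] by simp
    then show ?thesis
      unfolding w_def[symmetric] S fx by (simp add: power2_eq_square power3_eq_cube algebra_simps)
  qed
  have small: "\<bar>?w x\<bar> < e" if "- a - a * e < x" "x < - a + a * e" for x
    using that \<open>0 < a\<close> by (simp add: abs_less_iff field_simps)
  have Dflux: "(flux f has_real_derivative ode_coeff m * f x) (at x)"
    if x: "- a - a * e < x" "x < - a + a * e" for x
  proof -
    have "((\<lambda>x. a ^ 3 * eval_fps (H * fps_deriv H + (fps_X - 1) * H) (?w x)) has_real_derivative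
        a ^ 3 * (eval_fps (fps_const (ode_coeff m) * H) (?w x) / a)) (at x)"
      using DERIV_cmult[OF D[OF radS small[OF x]], of "a ^ 3"]
      unfolding profile_fps_ode[OF m, folded H_def] .
    also have "eval_fps (fps_const (ode_coeff m) * H) (?w x) = ode_coeff m * eval_fps H (?w x)"
      by (subst eval_fps_mult[OF _ less[OF small[OF x] rad]]) simp_all
    also have "a ^ 3 * (ode_coeff m * eval_fps H (?w x) / a) = ode_coeff m * f x"
      using \<open>0 < a\<close> by (simp add: f_def series_solution_def H_def power2_eq_square power3_eq_cube)
    finally show ?thesis
    proof (rule DERIV_cong_ev[OF refl _ refl, THEN iffD1, rotated])
      show "eventually (\<lambda>x. a ^ 3 * eval_fps (H * fps_deriv H + (fps_X - 1) * H) (?w x) = flux f x) (nhds x)"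
        using eventually_nhds_in_open[of "{- a - a * e<..<- a + a * e}" x] x
        by (auto elim!: eventually_mono intro!: flux[symmetric] small)
    qed
  qed
  have w0: "\<bar>?w (- a)\<bar> < e" using e by simp
  have f0: "f (- a) = 0"
    by (simp add: f_def series_solution_def eval_fps_at_0 profile_fps_nth)
  have lim: "(f \<longlongrightarrow> 0) (at_right (- a))"
    using DERIV_isCont[OF Df[OF w0]] f0 by (simp add: isCont_def filterlim_at_split)
  have "isCont (\<lambda>x. a * eval_fps (fps_deriv H) (?w x)) (- a)"
    using D[OF rad' w0] by (intro continuous_intros) (auto intro: DERIV_isCont)
  moreover have "a * eval_fps (fps_deriv H) (?w (- a)) = a"
    by (simp add: eval_fps_at_0 H_def profile_fps_nth)
  ultimately have "((\<lambda>x. a * eval_fps (fps_deriv H) (?w x)) \<longlongrightarrow> a) (at_right (- a))"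
    by (simp only: isCont_def filterlim_at_split)
  then have lim': "(deriv f \<longlongrightarrow> a) (at_right (- a))"
  proof (rule Lim_transform_eventually)
    show "eventually (\<lambda>x. a * eval_fps (fps_deriv H) (?w x) = deriv f x) (at_right (- a))"
      unfolding eventually_at_right_field
    proof (intro exI[of _ "- a + a * e"] conjI allI impI)
      have ae: "0 < a * e" using e \<open>0 < a\<close> by simp
      then show "- a < - a + a * e" by simp
      show "a * eval_fps (fps_deriv H) (?w y) = deriv f y" if "- a < y" "y < - a + a * e" for y
        using df[OF small, of y] that ae by simp
    qed
  qed
  show ?thesis
    unfolding cauchy_solution_flux f_def[symmetric]
  proof (intro conjI allI impI lim lim')
    show "ereal (- a) < ereal (- a + a * e)" using e \<open>0 < a\<close> by simp
    fix x assume "- a < x \<and> ereal x < ereal (- a + a * e)"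
    moreover have "0 < a * e" using e \<open>0 < a\<close> by simp
    ultimately have x: "- a - a * e < x" "x < - a + a * e" by auto
    show "(f has_real_derivative deriv f x) (at x)" using Df df small[OF x] by simp
    show "(flux f has_real_derivative ode_coeff m * f x) (at x)" by (rule Dflux[OF x])
  qed
qed

section \<open>Existence away from the singular point\<close>

text \<open>
  Picard's theorem for a globally Lipschitz right-hand side, on the whole interval at once: with
  \<open>y t = exp (- K * (t - s)) * x t\<close> and \<open>K\<close> at least twice the Lipschitz constant, the integral operator
  is a contraction in the supremum norm, so no patching of short time steps is needed.
\<close>

lemma picard_lindeloef:
  fixes F :: "real \<Rightarrow> 'a :: banach \<Rightarrow> 'a"
  assumes "s \<le> T" and cont: "continuous_on ({s..T} \<times> UNIV) (\<lambda>(t, x). F t x)"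
    and lip: "\<And>t x y. t \<in> {s..T} \<Longrightarrow> norm (F t x - F t y) \<le> L * norm (x - y)"
  obtains x where "x s = x0"
    "\<And>t. t \<in> {s..T} \<Longrightarrow> (x has_vector_derivative F t (x t)) (at t within {s..T})"
proof -
  define K where "K = 2 * (\<bar>L\<bar> + 1)"
  have K: "0 < K" "\<bar>L\<bar> / K \<le> 1 / 2" by (auto simp: K_def field_simps)
  \<comment> \<open>Precomposition with this retraction extends functions on the interval to bounded continuous functions on the whole line, on which Banach's theorem applies.\<close>
  define c where "c = (\<lambda>t. max s (min T t))"
  have c: "c t \<in> {s..T}" "t \<in> {s..T} \<Longrightarrow> c t = t" for t using \<open>s \<le> T\<close> by (auto simp: c_def)
  define G where "G = (\<lambda>(y :: real \<Rightarrow>\<^sub>C 'a) r. F r (exp (K * (r - s)) *\<^sub>R y r))"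
  define J where "J = (\<lambda>y t. x0 + integral {s..t} (G y))"
  define P where "P = (\<lambda>y t. exp (- K * (c t - s)) *\<^sub>R J y (c t))"
  have G: "continuous_on {s..T} (G y)" for y
  proof -
    have "continuous_on {s..T} ((\<lambda>(t, x). F t x) \<circ> (\<lambda>r. (r, exp (K * (r - s)) *\<^sub>R y r)))"
      by (intro continuous_on_compose continuous_intros continuous_on_subset[OF cont]) auto
    then show ?thesis by (simp add: G_def o_def)
  qed
  then have G_int: "G y integrable_on {s..t}" if "t \<in> {s..T}" for y t
    using that by (intro integrable_continuous_interval continuous_on_subset[OF G]) auto
  have J: "continuous_on {s..T} (J y)" for y
    unfolding J_def using \<open>s \<le> T\<close>
    by (intro continuous_intros indefinite_integral_continuous_1 G_int) auto
  have P: "P y \<in> bcontfun" for y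
  proof -
    define h where "h = (\<lambda>t. exp (- K * (t - s)) *\<^sub>R J y t)"
    have h: "continuous_on {s..T} h" unfolding h_def by (intro continuous_intros J)
    have "continuous_on UNIV (\<lambda>t. h (c t))"
    proof (rule continuous_on_compose2[OF h])
      show "continuous_on UNIV c" unfolding c_def by (intro continuous_intros)
    qed (use c in auto)
    moreover have "bounded (range (\<lambda>t. h (c t)))"
      by (rule bounded_subset[OF compact_imp_bounded[OF compact_continuous_image[OF h compact_Icc]]])
         (use c in auto)
    ultimately show ?thesis by (simp add: bcontfun_def P_def h_def)
  qed
  have J_diff: "norm (J y t - J z t) \<le> (\<bar>L\<bar> / K * dist y z) * exp (K * (t - s))" if t: "t \<in> {s..T}" for y z t
  proof -
    define D where "D = \<bar>L\<bar> * dist y z"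
    have I: "((\<lambda>r. D * exp (K * (r - s))) has_integral
        D / K * exp (K * (t - s)) - D / K * exp (K * (s - s))) {s..t}"
    proof (rule fundamental_theorem_of_calculus)
      show "((\<lambda>r. D / K * exp (K * (r - s))) has_vector_derivative D * exp (K * (r - s))) (at r within {s..t})" for r
        unfolding has_real_derivative_iff_has_vector_derivative[symmetric]
        using K by (auto intro!: derivative_eq_intros)
    qed (use t in auto)
    have "norm (J y t - J z t) = norm (integral {s..t} (\<lambda>r. G y r - G z r))"
      using integral_diff[OF G_int[OF t] G_int[OF t]] by (simp add: J_def)
    also have "\<dots> \<le> integral {s..t} (\<lambda>r. D * exp (K * (r - s)))"
    proof (rule integral_norm_bound_integral)
      show "(\<lambda>r. G y r - G z r) integrable_on {s..t}" by (intro integrable_diff G_int t)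
      show "(\<lambda>r. D * exp (K * (r - s))) integrable_on {s..t}" using I by blast
      fix r assume r: "r \<in> {s..t}"
      have "norm (G y r - G z r) \<le> L * norm (exp (K * (r - s)) *\<^sub>R y r - exp (K * (r - s)) *\<^sub>R z r)"
        unfolding G_def using r t by (intro lip) auto
      also have "\<dots> = L * (exp (K * (r - s)) * dist (y r) (z r))"
        by (simp add: dist_norm flip: scaleR_diff_right)
      also have "\<dots> \<le> \<bar>L\<bar> * (exp (K * (r - s)) * dist y z)"
        by (intro mult_mono mult_left_mono dist_bounded) auto
      finally show "norm (G y r - G z r) \<le> D * exp (K * (r - s))" by (simp add: D_def mult_ac)
    qed
    also have "\<dots> = D / K * exp (K * (t - s)) - D / K"
      using integral_unique[OF I] by simp
    also have "\<dots> \<le> D / K * exp (K * (t - s))" using K by (simp add: D_def)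
    finally show ?thesis by (simp add: D_def mult_ac)
  qed
  have "dist (Bcontfun (P y)) (Bcontfun (P z)) \<le> 1 / 2 * dist y z" for y z
  proof (rule dist_bound)
    fix t
    have "dist (P y t) (P z t) = exp (- K * (c t - s)) * norm (J y (c t) - J z (c t))"
      by (simp add: P_def dist_norm flip: scaleR_diff_right)
    also have "\<dots> \<le> exp (- K * (c t - s)) * ((\<bar>L\<bar> / K * dist y z) * exp (K * (c t - s)))"
      by (intro mult_left_mono J_diff c) auto
    also have "\<dots> = \<bar>L\<bar> / K * dist y z"
      by (simp add: mult_exp_exp)
    also have "\<dots> \<le> 1 / 2 * dist y z" using K by (intro mult_right_mono) auto
    finally show "dist (apply_bcontfun (Bcontfun (P y)) t) (apply_bcontfun (Bcontfun (P z)) t) \<le> 1 / 2 * dist y z"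
      by (simp add: Bcontfun_inverse[OF P])
  qed
  then obtain y where "Bcontfun (P y) = y"
    using banach_fix_type[of "1 / 2" "\<lambda>y. Bcontfun (P y)"] by auto
  then have "apply_bcontfun y = P y" using Bcontfun_inverse[OF P] by metis
  then have y: "exp (K * (t - s)) *\<^sub>R y t = J y t" if "t \<in> {s..T}" for t
    using c(2)[OF that] by (simp add: P_def mult_exp_exp)
  show thesis
  proof (rule that[of "J y"])
    show "J y s = x0" by (simp add: J_def)
    fix t assume t: "t \<in> {s..T}"
    have "(J y has_vector_derivative G y t) (at t within {s..T})"
      unfolding J_def
      by (rule derivative_eq_intros integral_has_vector_derivative[OF G t] | simp)+
    then show "(J y has_vector_derivative F t (J y t)) (at t within {s..T})"
      using y[OF t] by (simp add: G_def)
  qed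
qed

lemma sqrt_lipschitz:
  assumes "0 < w" "w\<^sup>2 \<le> p" "w\<^sup>2 \<le> q"
  shows "\<bar>sqrt p - sqrt q\<bar> \<le> \<bar>p - q\<bar> / (2 * w)"
proof -
  have nn: "0 \<le> p" "0 \<le> q" using assms by (meson order_trans zero_le_power2)+
  have w: "w \<le> sqrt p" "w \<le> sqrt q" using assms by (auto intro: real_le_rsqrt)
  have "p - q = (sqrt p - sqrt q) * (sqrt p + sqrt q)"
    using nn by (simp add: algebra_simps)
  then have "\<bar>p - q\<bar> = \<bar>sqrt p - sqrt q\<bar> * (sqrt p + sqrt q)"
    using w \<open>0 < w\<close> by (simp add: abs_mult)
  also have "\<dots> \<ge> \<bar>sqrt p - sqrt q\<bar> * (2 * w)"
    using w by (intro mult_left_mono) auto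
  finally show ?thesis using \<open>0 < w\<close> by (simp add: pos_le_divide_eq)
qed

text \<open>
  The system \<open>f' = A / f - x, A' = k * f\<close> is neither bounded near \<open>f = 0\<close> nor globally Lipschitz.
  In terms of \<open>u = f\<^sup>2 / 2\<close> it reads \<open>u' = A - x * sqrt (2 * u), A' = k * sqrt (2 * u)\<close>, whose
  right-hand side is Lipschitz for \<open>u\<close> bounded away from \<open>0\<close>. Cutting off \<open>u\<close> from below at
  \<open>w\<^sup>2 / 2\<close> makes it globally Lipschitz, and the solution never reaches the cut-off: \<open>A\<close> does not
  decrease, hence at \<open>u = w\<^sup>2 / 2\<close> the derivative \<open>A - x * w\<close> of \<open>u\<close> would be positive.
\<close>

lemma regular_continuation:
  fixes f0 A0 k :: real
  assumes "s < T" "0 < f0" "0 < A0" "0 \<le> k"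
  obtains f A where "f s = f0" "A s = A0"
    "continuous_on {s..T} f" "continuous_on {s..T} A"
    "\<And>x. s \<le> x \<Longrightarrow> x < T \<Longrightarrow> 0 < f x"
    "\<And>x. s < x \<Longrightarrow> x < T \<Longrightarrow> (f has_real_derivative A x / f x - x) (at x)"
    "\<And>x. s < x \<Longrightarrow> x < T \<Longrightarrow> (A has_real_derivative k * f x) (at x)"
proof -
  \<comment> \<open>The bound by \<open>f0 / 2\<close> lets the solution start above the cut-off; the other one yields \<open>A0 - T * w > 0\<close>.\<close>
  define w where "w = min (f0 / 2) (A0 / (2 * (\<bar>T\<bar> + 1)))"
  have "w \<le> f0 / 2" unfolding w_def by (rule min.cobounded1)
  moreover have "0 < w" using assms by (simp add: w_def)
  ultimately have w: "0 < w" "w < f0" using \<open>0 < f0\<close> by auto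
  have "w \<le> A0 / (2 * (\<bar>T\<bar> + 1))" unfolding w_def by (rule min.cobounded2)
  then have "w * \<bar>T\<bar> + w \<le> A0 / 2" by (simp add: field_simps)
  then have wT: "\<bar>T\<bar> * w < A0" using w \<open>0 < A0\<close> by (simp add: mult.commute)
  define \<sigma> where "\<sigma> = (\<lambda>u. sqrt (2 * max u (w\<^sup>2 / 2)))"
  have \<sigma>_lip: "\<bar>\<sigma> u - \<sigma> v\<bar> \<le> \<bar>u - v\<bar> / w" for u v
  proof -
    have "\<bar>\<sigma> u - \<sigma> v\<bar> \<le> \<bar>2 * max u (w\<^sup>2 / 2) - 2 * max v (w\<^sup>2 / 2)\<bar> / (2 * w)"
      unfolding \<sigma>_def by (rule sqrt_lipschitz) (use w in auto)
    also have "\<dots> \<le> (2 * \<bar>u - v\<bar>) / (2 * w)"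
    proof (rule divide_right_mono)
      have "\<bar>max u c - max v c\<bar> \<le> \<bar>u - v\<bar>" for c by (auto simp: max_def)
      moreover have "\<bar>2 * p - 2 * q\<bar> \<le> 2 * d" if "\<bar>p - q\<bar> \<le> d" for p q d :: real
        using that by linarith
      ultimately show "\<bar>2 * max u (w\<^sup>2 / 2) - 2 * max v (w\<^sup>2 / 2)\<bar> \<le> 2 * \<bar>u - v\<bar>"
        by blast
    qed (use w in simp)
    finally show ?thesis using w by simp
  qed
  have \<sigma>_pos: "0 < \<sigma> u" for u using w by (simp add: \<sigma>_def less_max_iff_disj)
  define F where "F = (\<lambda>t (x :: real \<times> real). (snd x - t * \<sigma> (fst x), k * \<sigma> (fst x)))"
  define N where "N = max \<bar>s\<bar> \<bar>T\<bar>"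
  have F_lip: "norm (F t x - F t y) \<le> (1 + N / w + k / w) * norm (x - y)" if t: "t \<in> {s..T}" for t x y
  proof -
    define d where "d = norm (x - y)"
    have fst: "\<bar>fst x - fst y\<bar> \<le> d" and snd: "\<bar>snd x - snd y\<bar> \<le> d"
      using norm_fst_le[of "fst (x - y)" "snd (x - y)"] norm_snd_le[of "snd (x - y)" "fst (x - y)"]
      unfolding prod.collapse by (simp_all add: d_def)
    have \<sigma>: "\<bar>\<sigma> (fst x) - \<sigma> (fst y)\<bar> \<le> d / w"
      using \<sigma>_lip[of "fst x" "fst y"] divide_right_mono[OF fst, of w] w by linarith
    have "\<bar>t\<bar> \<le> N" using t by (auto simp: N_def)
    then have 1: "\<bar>t * (\<sigma> (fst x) - \<sigma> (fst y))\<bar> \<le> N * (d / w)"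
      unfolding abs_mult using \<sigma> by (intro mult_mono) auto
    have 2: "\<bar>k * (\<sigma> (fst x) - \<sigma> (fst y))\<bar> \<le> k * (d / w)"
      unfolding abs_mult using \<sigma> \<open>0 \<le> k\<close> by (intro mult_mono) auto
    have "F t x - F t y = ((snd x - snd y) - t * (\<sigma> (fst x) - \<sigma> (fst y)), k * (\<sigma> (fst x) - \<sigma> (fst y)))"
      by (simp add: F_def algebra_simps)
    then have "norm (F t x - F t y) \<le> \<bar>(snd x - snd y) - t * (\<sigma> (fst x) - \<sigma> (fst y))\<bar>
        + \<bar>k * (\<sigma> (fst x) - \<sigma> (fst y))\<bar>"
      using norm_Pair_le[of "(snd x - snd y) - t * (\<sigma> (fst x) - \<sigma> (fst y))"
          "k * (\<sigma> (fst x) - \<sigma> (fst y))"] by simp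
    also have "\<dots> \<le> d + N * (d / w) + k * (d / w)"
      using 1 2 snd by linarith
    finally show ?thesis by (simp add: d_def algebra_simps)
  qed
  have F_cont: "continuous_on ({s..T} \<times> UNIV) (\<lambda>(t, x). F t x)"
    unfolding F_def \<sigma>_def case_prod_beta by (intro continuous_intros)
  obtain X where X: "X s = (f0\<^sup>2 / 2, A0)"
    "\<And>t. t \<in> {s..T} \<Longrightarrow> (X has_vector_derivative F t (X t)) (at t within {s..T})"
    using picard_lindeloef[OF less_imp_le[OF \<open>s < T\<close>] F_cont F_lip] by blast
  define u where "u = (\<lambda>t. fst (X t))"
  define A where "A = (\<lambda>t. snd (X t))"
  have X_cont: "continuous_on {s..T} X"
    unfolding continuous_on_eq_continuous_within
    using has_vector_derivative_continuous[OF X(2)] by blast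
  then have u_cont: "continuous_on {s..T} u" and A_cont: "continuous_on {s..T} A"
    unfolding u_def A_def by (rule continuous_on_fst, rule continuous_on_snd)
  have X': "(X has_vector_derivative F t (X t)) (at t)" if "s < t" "t < T" for t
    using X(2)[of t] that at_within_Icc_at[of s t T] by simp
  have Du: "(u has_real_derivative A t - t * \<sigma> (u t)) (at t)"
    and DA: "(A has_real_derivative k * \<sigma> (u t)) (at t)" if t: "s < t" "t < T" for t
    using bounded_linear.has_vector_derivative[OF bounded_linear_fst X'[OF t]]
      bounded_linear.has_vector_derivative[OF bounded_linear_snd X'[OF t]]
    by (simp_all add: has_real_derivative_iff_has_vector_derivative u_def A_def F_def)
  have A_ge: "A0 \<le> A t" if t: "s \<le> t" "t \<le> T" for t
  proof -
    have "A s \<le> A t"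
    proof (rule DERIV_nonneg_imp_increasing_open[OF t(1)])
      show "continuous_on {s..t} A" by (rule continuous_on_subset[OF A_cont]) (use t in auto)
      show "\<exists>y. (A has_real_derivative y) (at x) \<and> 0 \<le> y" if "s < x" "x < t" for x
        using DA[of x] that t \<sigma>_pos[of "u x"] \<open>0 \<le> k\<close> by (intro exI[of _ "k * \<sigma> (u x)"]) auto
    qed
    then show ?thesis using X(1) by (simp add: A_def)
  qed
  have "w\<^sup>2 < f0\<^sup>2" using w by (intro power_strict_mono) auto
  then have us: "w\<^sup>2 / 2 < u s" using X(1) by (simp add: u_def)
  have "(u \<longlongrightarrow> u s) (at_right s)"
    using u_cont \<open>s < T\<close> by (auto simp: continuous_on at_within_Icc_at_right dest: bspec[of _ _ s])
  then have ev: "eventually (\<lambda>t. 0 < u t - w\<^sup>2 / 2) (at_right s)"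
    using order_tendstoD(1)[OF _ us] by simp
  have u_gt: "w\<^sup>2 / 2 < u t" if t: "s < t" "t < T" for t
  proof (rule ccontr)
    assume "\<not> w\<^sup>2 / 2 < u t"
    then have "u t - w\<^sup>2 / 2 \<le> 0" by simp
    obtain z where z: "s < z" "z \<le> t" "u z - w\<^sup>2 / 2 = 0" "\<And>x. s < x \<Longrightarrow> x < z \<Longrightarrow> 0 < u x - w\<^sup>2 / 2"
    proof (rule first_zero[OF ev _ t(1) \<open>u t - w\<^sup>2 / 2 \<le> 0\<close>])
      show "isCont (\<lambda>t. u t - w\<^sup>2 / 2) x" if "s < x" "x \<le> t" for x
        using that t by (intro continuous_intros DERIV_isCont[OF Du]) auto
    qed (rule that)
    have "u z = w\<^sup>2 / 2" using z(3) by simp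
    then have "\<sigma> (u z) = w" using w by (simp only: \<sigma>_def) simp
    moreover have "z * w \<le> \<bar>T\<bar> * w" using z(2) t w by (intro mult_right_mono) auto
    ultimately have "0 < A z - z * \<sigma> (u z)" using A_ge[of z] wT z t by simp
    then obtain d where d: "0 < d" "\<And>h. 0 < h \<Longrightarrow> h < d \<Longrightarrow> u (z - h) < u z"
      using DERIV_pos_inc_left[OF Du[of z]] z t by auto
    define h where "h = min (d / 2) ((z - s) / 2)"
    have "h \<le> d / 2" "h \<le> (z - s) / 2"
      unfolding h_def by (rule min.cobounded1, rule min.cobounded2)
    moreover have "0 < h" using d(1) z(1) by (simp add: h_def)
    ultimately have "u (z - h) < u z" "0 < u (z - h) - w\<^sup>2 / 2"
      using d(2)[of h] z(4)[of "z - h"] d(1) z(1) by simp_all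
    then show False using z(3) by simp
  qed
  define f where "f = (\<lambda>t. sqrt (2 * u t))"
  have \<sigma>f: "\<sigma> (u t) = f t" if "s < t" "t < T" for t
    using u_gt[OF that] by (simp add: \<sigma>_def f_def max_def)
  show thesis
  proof (rule that[of f A])
    show "f s = f0" using X(1) \<open>0 < f0\<close> by (simp add: f_def u_def)
    show "A s = A0" using X(1) by (simp add: A_def)
    show "continuous_on {s..T} f" unfolding f_def by (intro continuous_intros u_cont)
    show "continuous_on {s..T} A" by (rule A_cont)
    show "0 < f x" if "s \<le> x" "x < T" for x
    proof -
      have "w\<^sup>2 / 2 < u x" using us u_gt[of x] that by (cases "x = s") auto
      moreover have "0 \<le> w\<^sup>2 / 2" by simp
      ultimately have "0 < u x" by (rule le_less_trans[rotated])
      then show ?thesis by (simp add: f_def)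
    qed
    fix x assume x: "s < x" "x < T"
    have pos: "0 < u x" using u_gt[OF x] by (smt (verit) half_gt_zero_iff w(1) zero_less_power)
    have "(f has_real_derivative (2 * (A x - x * f x)) * (inverse (sqrt (2 * u x)) / 2)) (at x)"
      unfolding f_def using pos Du[OF x] \<sigma>f[OF x]
      by (auto intro!: derivative_eq_intros simp: f_def)
    moreover have "(2 * (A x - x * f x)) * (inverse (sqrt (2 * u x)) / 2) = A x / f x - x"
      using pos by (simp add: f_def field_simps)
    ultimately show "(f has_real_derivative A x / f x - x) (at x)" by (simp only:)
    show "(A has_real_derivative k * f x) (at x)" using DA[OF x] \<sigma>f[OF x] by simp
  qed
qed

section \<open>Extension and the maximal solution\<close>

lemma deriv_eventually_eq:
  assumes "eventually (\<lambda>y. g y = f y) (nhds (x :: real))"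
  shows "eventually (\<lambda>y. deriv g y = deriv f y) (nhds x)"
proof -
  have "eventually (\<lambda>z. eventually (\<lambda>y. g y = f y) (nhds z)) (nhds x)"
    using assms by (simp add: eventually_eventually)
  then show ?thesis by (rule eventually_mono) (rule deriv_cong_ev, auto)
qed

text \<open>
  Being a solution is a local property apart from the behaviour at the singular point, so
  solutions may be glued from pieces.
\<close>

lemma cauchy_solution_local:
  assumes start: "cauchy_solution m a c h" "- a < q" "\<And>x. - a < x \<Longrightarrow> x < q \<Longrightarrow> g x = h x"
    and b: "ereal (- a) < b"
    and loc: "\<And>x. - a < x \<Longrightarrow> ereal x < b \<Longrightarrow> \<exists>f. eventually (\<lambda>y. g y = f y) (nhds x) \<and>
       (f has_real_derivative deriv f x) (at x) \<and> (flux f has_real_derivative ode_coeff m * f x) (at x)"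
  shows "cauchy_solution m a b g"
  unfolding cauchy_solution_flux
proof (intro conjI allI impI b)
  fix x assume "- a < x \<and> ereal x < b"
  then obtain f where ev: "eventually (\<lambda>y. g y = f y) (nhds x)"
    and D: "(f has_real_derivative deriv f x) (at x)" "(flux f has_real_derivative ode_coeff m * f x) (at x)"
    using loc by blast
  have eq: "g x = f x" "deriv g x = deriv f x"
    using eventually_nhds_x_imp_x[OF ev] eventually_nhds_x_imp_x[OF deriv_eventually_eq[OF ev]] by auto
  have ev': "eventually (\<lambda>y. flux g y = flux f y) (nhds x)"
    using ev deriv_eventually_eq[OF ev] by eventually_elim (simp add: flux_def)
  show "(g has_real_derivative deriv g x) (at x)"
    using D(1) DERIV_cong_ev[OF refl ev refl] eq by simp
  show "(flux g has_real_derivative ode_coeff m * g x) (at x)"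
    using D(2) DERIV_cong_ev[OF refl ev' refl] eq by simp
next
  have nhd: "eventually (\<lambda>y. g y = h y) (nhds x)" if "- a < x" "x < q" for x
    using eventually_nhds_in_open[of "{- a<..<q}" x] that start(3) by (auto elim!: eventually_mono)
  show "(g \<longlongrightarrow> 0) (at_right (- a))"
    by (rule Lim_transform_eventually[OF cauchy_solutionD(4)[OF start(1)]])
       (use start(2,3) in \<open>auto simp: eventually_at_right_field\<close>)
  show "(deriv g \<longlongrightarrow> a) (at_right (- a))"
  proof (rule Lim_transform_eventually[OF cauchy_solutionD(5)[OF start(1)]])
    have "deriv h y = deriv g y" if "- a < y" "y < q" for y
      using eventually_nhds_x_imp_x[OF deriv_eventually_eq[OF nhd[OF that]]] by simp
    then show "eventually (\<lambda>y. deriv h y = deriv g y) (at_right (- a))"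
      using start(2) by (auto simp: eventually_at_right_field)
  qed
qed

lemma flux_pos:
  assumes sol: "cauchy_solution m a b f" and "0 < a" and k: "0 < ode_coeff m"
    and x: "- a < x" "ereal x < b"
  shows "0 < flux f x"
proof -
  have dom: "ereal y < b" if "y \<le> x" for y
    using that x(2) by (metis ereal_less_eq(3) le_less_trans)
  have D: "(flux f has_real_derivative ode_coeff m * f y) (at y)" if "- a < y" "y \<le> x" for y
    using cauchy_solutionD(3)[OF sol] that dom by auto
  obtain y where y: "- a < y" "y < x" "flux f x - 0 = ode_coeff m * f y * (x - - a)"
    by (rule mvt_right[OF x(1), of "flux f" "\<lambda>y. ode_coeff m * f y" 0])
       (use D x flux_tendsto_0[OF sol] in \<open>auto intro: DERIV_isCont\<close>)
  moreover have "0 < f y" using cauchy_solution_pos[OF sol \<open>0 < a\<close>, of y] k y dom[of y] by simp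
  ultimately show ?thesis using k x by simp
qed

text \<open>
  A regular solution that takes over the values of \<open>f\<close> and \<open>flux f\<close> at an interior point \<open>s\<close> agrees
  with \<open>f\<close> on \<open>[s, q]\<close>. Because of this overlap the two pieces can be glued at \<open>q\<close> without any
  condition on one-sided derivatives. The sign of the coefficient enters through the positivity of
  the flux and its monotonicity.
\<close>

lemma solution_extends:
  assumes sol: "cauchy_solution m a b f" and "0 < a" and k: "0 < ode_coeff m" and T: "- a < T"
  obtains g where "cauchy_solution m a (ereal T) g"
proof (cases "ereal T \<le> b")
  case True
  then show thesis using that[OF cauchy_solution_restrict[OF sol]] T by simp
next
  case False
  obtain s q where sq: "- a < s" "s < q" "ereal q < b"
  proof -
    obtain q where "- a < q" "\<And>x. x \<le> q \<Longrightarrow> ereal x < b"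
      using ereal_upper_nhd[OF cauchy_solutionD(1)[OF sol]] by blast
    then show thesis using that[of "(q - a) / 2" q] by simp
  qed
  have dom: "ereal x < b" if "x \<le> q" for x
    using that sq(3) by (metis ereal_less_eq(3) le_less_trans)
  have "q < T" using False sq(3) by (metis less_ereal.simps(1) less_trans not_le)
  have pos: "0 < f x" "0 < flux f x" if "- a < x" "x \<le> q" for x
    using cauchy_solution_pos[OF sol \<open>0 < a\<close>] flux_pos[OF sol \<open>0 < a\<close> k] k that dom by auto
  have Df: "(f has_real_derivative deriv f x) (at x)"
    "(flux f has_real_derivative ode_coeff m * f x) (at x)" if "- a < x" "x \<le> q" for x
    using cauchy_solutionD(2,3)[OF sol] that dom by auto
  have "s < T" "0 < f s" "0 < flux f s" "0 \<le> ode_coeff m"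
    using sq \<open>q < T\<close> pos k by auto
  then obtain h A where init: "h s = f s" "A s = flux f s"
    and cont: "continuous_on {s..T} h" "continuous_on {s..T} A"
    and h: "\<And>x. s \<le> x \<Longrightarrow> x < T \<Longrightarrow> 0 < h x"
      "\<And>x. s < x \<Longrightarrow> x < T \<Longrightarrow> (h has_real_derivative A x / h x - x) (at x)"
      "\<And>x. s < x \<Longrightarrow> x < T \<Longrightarrow> (A has_real_derivative ode_coeff m * h x) (at x)"
    by (rule regular_continuation) (rule that)
  have agree: "f x = h x" if x: "s \<le> x" "x \<le> q" for x
  proof (rule regular_uniqueness[OF x(1), where A = "flux f" and B = A and k = "ode_coeff m"])
    have "isCont f y" "isCont (flux f) y" if "y \<in> {s..x}" for y
      using Df[of y] that x sq by (auto dest: DERIV_isCont)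
    then show "continuous_on {s..x} f" "continuous_on {s..x} (flux f)"
      by (auto intro: continuous_at_imp_continuous_on)
    show "continuous_on {s..x} h" "continuous_on {s..x} A"
      using cont x \<open>q < T\<close> by (auto elim!: continuous_on_subset)
    fix y
    show "0 < f y" "0 < h y" if "y \<in> {s..x}"
      using that x sq \<open>q < T\<close> pos(1)[of y] h(1)[of y] by auto
    assume y: "s < y" "y < x"
    then have "deriv f y = flux f y / f y - y"
      using pos(1)[of y] x sq by (simp add: flux_def field_simps)
    then show "(f has_real_derivative flux f y / f y - y) (at y)"
      using Df(1)[of y] y x sq by simp
    show "(flux f has_real_derivative ode_coeff m * f y) (at y)"
      using Df(2)[of y] y x sq by simp
    show "(h has_real_derivative A y / h y - y) (at y)" "(A has_real_derivative ode_coeff m * h y) (at y)"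
      using h(2,3)[of y] y x \<open>q < T\<close> by auto
  qed (use init in auto)
  define g where "g = (\<lambda>x. if x < q then f x else h x)"
  have "cauchy_solution m a (ereal T) g"
  proof (rule cauchy_solution_local[OF sol])
    show "- a < q" "ereal (- a) < ereal T" using sq T by auto
    show "g x = f x" if "- a < x" "x < q" for x using that by (simp add: g_def)
    fix x assume x: "- a < x" "ereal x < ereal T"
    show "\<exists>f. eventually (\<lambda>y. g y = f y) (nhds x) \<and>
       (f has_real_derivative deriv f x) (at x) \<and> (flux f has_real_derivative ode_coeff m * f x) (at x)"
    proof (cases "x < q")
      case True
      have "eventually (\<lambda>y. g y = f y) (nhds x)"
        using eventually_nhds_in_open[of "{..<q}" x] True by (auto elim!: eventually_mono simp: g_def)
      then show ?thesis using Df[of x] x True by auto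
    next
      case False
      then have xs: "s < x" "x < T" using sq x by auto
      have dh: "deriv h y = A y / h y - y" if "s < y" "y < T" for y
        using DERIV_imp_deriv[OF h(2)[OF that]] .
      have "eventually (\<lambda>y. flux h y = A y) (nhds x)"
        using eventually_nhds_in_open[of "{s<..<T}" x] xs
      proof (auto elim!: eventually_mono)
        fix y assume y: "s < y" "y < T"
        show "flux h y = A y" using dh[OF y] h(1)[of y] y by (simp add: flux_def field_simps)
      qed
      then have "(flux h has_real_derivative ode_coeff m * h x) (at x)"
        using DERIV_cong_ev[OF refl _ refl] h(3)[OF xs] by blast
      moreover have "eventually (\<lambda>y. g y = h y) (nhds x)"
        using eventually_nhds_in_open[of "{s<..<T}" x] xs agree
        by (auto elim!: eventually_mono simp: g_def)
      ultimately show ?thesis using h(2)[OF xs] dh[OF xs] by auto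
    qed
  qed
  then show thesis by (rule that)
qed

text \<open>
  By uniqueness all solutions are restrictions of one function, on the union of their intervals.
\<close>

lemma maximal_solution:
  assumes sol: "cauchy_solution m a c0 h" and "0 < a"
  obtains b f where "cauchy_solution m a b f"
    "\<And>c g. cauchy_solution m a c g \<Longrightarrow> c \<le> b"
    "\<And>c g x. cauchy_solution m a c g \<Longrightarrow> - a < x \<Longrightarrow> ereal x < c \<Longrightarrow> g x = f x"
proof -
  define b where "b = Sup {c. \<exists>g. cauchy_solution m a c g}"
  define f where "f = (\<lambda>x. SOME y. \<exists>c g. cauchy_solution m a c g \<and> ereal x < c \<and> y = g x)"
  have upper: "c \<le> b" if "cauchy_solution m a c g" for c g
    unfolding b_def using that by (auto intro: Sup_upper)
  have eq: "g x = f x" if g: "cauchy_solution m a c g" and x: "- a < x" "ereal x < c" for c g x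
  proof -
    have "\<exists>c' g'. cauchy_solution m a c' g' \<and> ereal x < c' \<and> f x = g' x"
      unfolding f_def by (rule someI_ex) (use g x in blast)
    then show ?thesis using cauchy_solution_unique[OF g _ \<open>0 < a\<close> x(1,2)] by force
  qed
  obtain q where q: "- a < q" "\<And>x. x \<le> q \<Longrightarrow> ereal x < c0"
    using ereal_upper_nhd[OF cauchy_solutionD(1)[OF sol]] by blast
  have "cauchy_solution m a b f"
  proof (rule cauchy_solution_local[OF sol q(1)])
    show "f x = h x" if "- a < x" "x < q" for x
      using eq[OF sol that(1)] q(2)[of x] that by simp
    show "ereal (- a) < b" using cauchy_solutionD(1)[OF sol] upper[OF sol] by (rule less_le_trans)
    fix x assume x: "- a < x" "ereal x < b"
    then obtain c g where g: "cauchy_solution m a c g" "ereal x < c"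
      unfolding b_def less_Sup_iff by blast
    obtain r where r: "x < r" "\<And>y. y \<le> r \<Longrightarrow> ereal y < c"
      using ereal_upper_nhd[OF g(2)] by blast
    have "eventually (\<lambda>y. f y = g y) (nhds x)"
      using eventually_nhds_in_open[of "{- a<..<r}" x] x r eq[OF g(1)]
      by (auto elim!: eventually_mono)
    then show "\<exists>f'. eventually (\<lambda>y. f y = f' y) (nhds x) \<and>
       (f' has_real_derivative deriv f' x) (at x) \<and> (flux f' has_real_derivative ode_coeff m * f' x) (at x)"
      using cauchy_solutionD(2,3)[OF g(1) x(1) g(2)] by blast
  qed
  then show thesis using that upper eq by blast
qed

section \<open>Explicit solutions\<close>

lemma explicit_solution:
  assumes "\<And>x. (f has_real_derivative f' x) (at x)"
    and "\<And>x. ((\<lambda>x. f x * f' x + x * f x) has_real_derivative ode_coeff m * f x) (at x)"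
    and "f (- a) = 0" "f' (- a) = a" "isCont f' (- a)"
  shows "cauchy_solution m a \<infinity> f"
proof -
  have d: "deriv f = f'" using assms(1) DERIV_imp_deriv by blast
  have "isCont f (- a)" using assms(1) DERIV_isCont by blast
  with assms show ?thesis
    unfolding cauchy_solution_flux flux_def[abs_def] d
    by (auto simp: isCont_def filterlim_at_split)
qed

lemma linear_solution: "cauchy_solution \<infinity> a \<infinity> (\<lambda>x. a * (x + a))"
  by (rule explicit_solution[where f' = "\<lambda>_. a"])
     (auto intro!: derivative_eq_intros simp: ode_coeff_def algebra_simps)

lemma parabolic_solution: "cauchy_solution (ereal (1 / 2)) a \<infinity> (\<lambda>x. (a\<^sup>2 - x\<^sup>2) / 2)"
  by (rule explicit_solution[where f' = "\<lambda>x. - x"])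
     (auto intro!: derivative_eq_intros simp: ode_coeff_def power2_eq_square field_simps)

section \<open>The singular Cauchy problem\<close>

theorem theorem6p1:
  fixes a :: real and m :: ereal
  assumes "a > 0" and "m \<noteq> 0" and "m \<noteq> - \<infinity>"
  shows "\<exists>b f.
    cauchy_solution m a b f \<and>
    (\<forall>c g. cauchy_solution m a c g \<longrightarrow>
       c \<le> b \<and> (\<forall>\<Phi>. - a < \<Phi> \<and> ereal \<Phi> < c \<longrightarrow> g \<Phi> = f \<Phi>)) \<and>
    (\<exists>r F. r > 0 \<and> ereal (- a + r) \<le> b \<and>
       F holomorphic_on ball (complex_of_real (- a)) r \<and>
       (\<forall>\<Phi>. - a < \<Phi> \<and> \<Phi> < - a + r \<longrightarrow> F (complex_of_real \<Phi>) = complex_of_real (f \<Phi>)) \<and>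
       (\<forall>z \<in> ball (complex_of_real (- a)) r.
          summable (\<lambda>k. of_real (chi m (Suc k)) * (z + of_real a) ^ Suc k / of_real a ^ Suc k) \<and>
          F z = of_real a * (z + of_real a) *
            (1 + (\<Sum>k. of_real (chi m (Suc k)) * (z + of_real a) ^ Suc k / of_real a ^ Suc k)))) \<and>
    (m = \<infinity> \<longrightarrow> b = \<infinity> \<and> (\<forall>\<Phi> > - a. f \<Phi> = a * (\<Phi> + a))) \<and>
    (m = ereal (1 / 2) \<longrightarrow> b = \<infinity> \<and>
       (\<forall>\<Phi> > - a. f \<Phi> = (a\<^sup>2 - \<Phi>\<^sup>2) / 2 \<and>
                  f \<Phi> = a * (\<Phi> + a) * (1 - (\<Phi> + a) / (2 * a)))) \<and>
    (ereal (1 / 2) < m \<and> m < \<infinity> \<longrightarrow> b = \<infinity> \<and> (\<forall>\<Phi> > - a. f \<Phi> > 0))"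
proof -
  obtain e where e: "0 < e" "\<And>k. \<bar>chi m k\<bar> * e ^ k \<le> 1"
    using chi_geometric_bound[OF assms(2,3)] by metis
  define r where "r = a * e"
  have "0 < r" using e assms(1) by (simp add: r_def)
  have ser: "cauchy_solution m a (ereal (- a + r)) (series_solution m a)"
    unfolding r_def by (rule cauchy_solution_series[OF assms(2,3,1) e])
  obtain b f where sol: "cauchy_solution m a b f"
    and upper: "\<And>c g. cauchy_solution m a c g \<Longrightarrow> c \<le> b"
    and eq: "\<And>c g x. cauchy_solution m a c g \<Longrightarrow> - a < x \<Longrightarrow> ereal x < c \<Longrightarrow> g x = f x"
    using maximal_solution[OF ser assms(1)] by blast
  have explicit: "b = \<infinity> \<and> (\<forall>x > - a. f x = g x)" if "cauchy_solution m a \<infinity> g" for g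
    using upper[OF that] eq[OF that] by auto

  define F where "F = (\<lambda>z :: complex. of_real a * (z + of_real a) * eval_fps (chi_fps m) ((z + of_real a) / of_real a))"
  have w: "norm ((z + of_real a) / of_real a) < e" if "z \<in> ball (complex_of_real (- a)) r" for z
  proof -
    have "norm (z + of_real a) < a * e"
      using that by (simp add: dist_norm r_def norm_minus_commute)
    then show ?thesis using assms(1) by (simp add: norm_divide pos_divide_less_eq mult.commute)
  qed
  have "F holomorphic_on ball (complex_of_real (- a)) r"
    unfolding F_def
  proof (intro holomorphic_intros)
    have "eval_fps (chi_fps m) holomorphic_on ball (0 :: complex) e"
      by (intro holomorphic_on_eval_fps ball_eball_mono chi_fps_conv_radius e(2))
    then have "eval_fps (chi_fps m) \<circ> (\<lambda>z. (z + of_real a) / of_real a) holomorphic_on ball (complex_of_real (- a)) r"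
      by (rule holomorphic_on_compose_gen[rotated])
         (use w assms(1) in \<open>auto intro!: holomorphic_intros\<close>)
    then show "(\<lambda>z. eval_fps (chi_fps m) ((z + of_real a) / of_real a)) holomorphic_on ball (complex_of_real (- a)) r"
      by (simp add: o_def)
  qed
  moreover have "F (complex_of_real x) = complex_of_real (f x)" if x: "- a < x" "x < - a + r" for x
  proof -
    have small: "\<bar>(x + a) / a\<bar> < e"
      using x assms(1) by (simp add: r_def field_simps)
    have "f x = a * (x + a) * eval_fps (chi_fps m) ((x + a) / a)"
      using eq[OF ser x(1)] x(2) assms(1)
      by (simp add: series_solution_def eval_profile_fps[OF e(2) small] power2_eq_square)
    then show ?thesis
      using eval_chi_fps_of_real[OF e(2) small, where 'a = complex] by (simp add: F_def)
  qed
  moreover have "summable (\<lambda>k. of_real (chi m (Suc k)) * (z + of_real a) ^ Suc k / of_real a ^ Suc k) \<and>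
      F z = of_real a * (z + of_real a) *
            (1 + (\<Sum>k. of_real (chi m (Suc k)) * (z + of_real a) ^ Suc k / of_real a ^ Suc k))"
    if "z \<in> ball (complex_of_real (- a)) r" for z
    using chi_series[OF e(2) w[OF that]] by (simp only: F_def power_divide times_divide_eq_right)
  ultimately have series: "\<exists>r F. r > 0 \<and> ereal (- a + r) \<le> b \<and>
       F holomorphic_on ball (complex_of_real (- a)) r \<and>
       (\<forall>\<Phi>. - a < \<Phi> \<and> \<Phi> < - a + r \<longrightarrow> F (complex_of_real \<Phi>) = complex_of_real (f \<Phi>)) \<and>
       (\<forall>z \<in> ball (complex_of_real (- a)) r.
          summable (\<lambda>k. of_real (chi m (Suc k)) * (z + of_real a) ^ Suc k / of_real a ^ Suc k) \<and>
          F z = of_real a * (z + of_real a) *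
            (1 + (\<Sum>k. of_real (chi m (Suc k)) * (z + of_real a) ^ Suc k / of_real a ^ Suc k)))"
    using \<open>0 < r\<close> upper[OF ser] by blast
  have global: "b = \<infinity> \<and> (\<forall>x > - a. f x > 0)" if m: "ereal (1 / 2) < m" "m < \<infinity>"
  proof -
    obtain p where p: "m = ereal p" using m by (cases m) auto
    with m(1) have "1 / 2 < p" by simp
    with p have k: "0 < ode_coeff m" by (simp add: ode_coeff_def)
    have "b = \<infinity>"
    proof (rule ereal_top)
      fix B :: real
      show "ereal B \<le> b"
        using solution_extends[OF sol assms(1) k, of "max B 0"] upper assms(1)
        by (metis ereal_less_eq(3) max.cobounded1 max.strict_coboundedI2 neg_less_0_iff_less order_trans)
    qed
    moreover have "f x > 0" if "- a < x" for x
      using cauchy_solution_pos[OF sol assms(1) _ that] k \<open>b = \<infinity>\<close> by simp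
    ultimately show ?thesis by blast
  qed
  have parabola: "b = \<infinity> \<and> (\<forall>\<Phi> > - a. f \<Phi> = (a\<^sup>2 - \<Phi>\<^sup>2) / 2 \<and>
                  f \<Phi> = a * (\<Phi> + a) * (1 - (\<Phi> + a) / (2 * a)))" if "m = ereal (1 / 2)"
  proof -
    have "(a\<^sup>2 - x\<^sup>2) / 2 = a * (x + a) * (1 - (x + a) / (2 * a))" for x
      using assms(1) by (simp add: field_simps power2_eq_square)
    then show ?thesis using explicit[OF parabolic_solution[folded that]] by auto
  qed
  show ?thesis
  proof (rule exI[of _ b], rule exI[of _ f], intro conjI)
    show "\<forall>c g. cauchy_solution m a c g \<longrightarrow>
       c \<le> b \<and> (\<forall>\<Phi>. - a < \<Phi> \<and> ereal \<Phi> < c \<longrightarrow> g \<Phi> = f \<Phi>)"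
      using upper eq by blast
    show "m = \<infinity> \<longrightarrow> b = \<infinity> \<and> (\<forall>\<Phi> > - a. f \<Phi> = a * (\<Phi> + a))"
      using explicit linear_solution[of a] by auto
    show "m = ereal (1 / 2) \<longrightarrow> b = \<infinity> \<and>
       (\<forall>\<Phi> > - a. f \<Phi> = (a\<^sup>2 - \<Phi>\<^sup>2) / 2 \<and>
                  f \<Phi> = a * (\<Phi> + a) * (1 - (\<Phi> + a) / (2 * a)))"
      by (rule impI) (rule parabola)
    show "ereal (1 / 2) < m \<and> m < \<infinity> \<longrightarrow> b = \<infinity> \<and> (\<forall>\<Phi> > - a. f \<Phi> > 0)"
      by (rule impI, erule conjE) (rule global)
  qed (rule sol, rule series)
qed

end
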